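(* Consider any positive integers $\omega,\ell,n$. (i) If $n\ge\omega+\ell+1$, then there exists a problem $$\text{(SDP)}\qquad \min\{\langle A_0,X\rangle:\ b_i^l\le\langle A_i,X\rangle\le b_i^u\ \ \forall i\in[m],\ X\in\mathbb{S}^n_+\}$$ with $(G,\ell)$-SPLR structure such that $\mathrm{pw}(G)=\mathrm{tw}(G)=\omega$ and the rank of any optimal solution is at least $\mathrm{tw}(G)+\ell+1$. (ii) If $\omega\ge3\ell-1$ and $n\ge\omega+3\ell+1$, then there exists a problem (SDP) of the same form with $(G,\ell)$-SPLR structure such that $\mathrm{tw}(G)=\omega$ and the rank of any optimal solution is at least $\mathrm{tw}(G)+\varphi(\ell)+1$.
   Context: Notation. $[n]=\{1,\dots,n\}$; $\mathbb{S}^n$ is the space of real symmetric $n\times n$ matrices with trace inner product $\langle\cdot,\cdot\rangle$, and $\mathbb{S}^n_+$ its positive semidefinite cone. Graphs are simple and undirected. For a graph $G=([n],\mathcal{E})$, $\mathbb{S}^n(\mathcal{E},0)=\{X\in\mathbb{S}^n: X_{ij}=X_{ji}=0 \text{ whenever } i\ne j,\ ij\notin\mathcal{E}\}$. SDP data. In (SDP), $A_i\in\mathbb{S}^n$ for $i\in\{0,1,\dots,m\}$ and $-\infty\le b_i^l\le b_i^u<+\infty$ for $i\in[m]$. SPLR structure. For a graph $G=([n],\mathcal{E})$, (SDP) has $(G,\ell)$-SPLR (sparse plus low-rank) structure if there exists a decomposition $A_i=A_i^s+A_i^l$ of its coefficient matrices with $A_i^s\in\mathbb{S}^n(\mathcal{E},0)$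 for all $i\in\{0,\dots,m\}$ and $\mathrm{rank}([A_0^l,A_1^l,\dots,A_m^l])\le\ell$ (column-wise concatenation). Tree-width $\mathrm{tw}(G)$ and path-width $\mathrm{pw}(G)$: a tree decomposition of $G=([n],\mathcal{E})$ is a pair $(T,\{V_t\}_{t\in T})$ with $T$ a tree and $V_t\subset[n]$ such that (a) $[n]=\bigcup_t V_t$; (b) every edge $ij\in\mathcal{E}$ has $i,j\in V_t$ for some $t$; (c) if $t_2$ lies on the path of $T$ from $t_1$ to $t_3$ then $V_{t_1}\cap V_{t_3}\subset V_{t_2}$. Its width is $\max_t|V_t|-1$; $\mathrm{tw}(G)$ is the minimum width over all tree decompositions, and $\mathrm{pw}(G)$ the minimum width over those with $T$ a path. The function $\varphi:\mathbb{N}\to\mathbb{N}$: $\varphi(0)=0$, and for $\ell\ge1$, $\varphi(\ell)$ is the smallest integer such that for any $U\in\mathbb{R}^{2\ell\times\ell}$ and $M\in\mathbb{S}^\ell$ the set $$\{Y\in\mathbb{S}^{2\ell}_+:\ U^\top YU=M,\ Y_{1:\ell,1:\ell}=I_\ell,\ Y_{\ell+1:2\ell,\ell+1:2\ell}=I_\ell\}$$ is either empty or contains an element of rank at most $\varphi(\ell)$. Here $Y_{a:b,c:d}$ is the submatrix with rows $a,\dots,b$ and columns $c,\dots,d$, and $I_\ell$ is the $\ell\times\ell$ identity matrix. *)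

theory Defs
  imports
    "HOL-Library.Extended_Real"
    "Jordan_Normal_Form.DL_Rank"
    "Graph_Theory.Digraph_Component_Vwalk"
begin

text \<open>
  Indices start at 0: the vertex set, written $[n]$ on paper, is \<open>{..<n}\<close>, and matrix rows and
  columns are numbered from 0.
\<close>

section \<open>Simple graphs, trees, tree-width and path-width\<close>

text \<open>
  A simple undirected graph is a \<open>pair_graph\<close>: finite, loop-free, with a symmetric set of arcs;
  \<open>(i, j) \<in> parcs G\<close> means that \<open>ij\<close> is an edge.
\<close>

definition graph_on :: "nat \<Rightarrow> nat pair_pre_digraph \<Rightarrow> bool" where
  "graph_on n G \<longleftrightarrow> pair_graph G \<and> pverts G = {..<n}"

text \<open>
  The constants \<open>forest\<close> and \<open>tree\<close> of Graph_Theory forbid directed cycles, so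
  no symmetric graph with an edge satisfies them. Here a cycle has at least three vertices.
\<close>

definition tree_graph :: "'a pair_pre_digraph \<Rightarrow> bool" where
  "tree_graph T \<longleftrightarrow> pair_graph T \<and> connected (with_proj T) \<and>
     \<not> (\<exists>p. vpath p (with_proj T) \<and> length p \<ge> 3 \<and> (last p, hd p) \<in> parcs T)"

definition path_graph :: "'a pair_pre_digraph \<Rightarrow> bool" where
  "path_graph T \<longleftrightarrow> (\<exists>p. p \<noteq> [] \<and> distinct p \<and> pverts T = set p \<and>
     parcs T = set (vwalk_arcs p) \<union> (set (vwalk_arcs p))\<inverse>)"

text \<open>
  In a tree there is exactly one path between two nodes, so quantifying over all paths \<open>p\<close>
  in the last condition is the same as speaking of \<^emph>\<open>the\<close> path.
\<close>

definition tree_decomposition ::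
    "'v pair_pre_digraph \<Rightarrow> 't pair_pre_digraph \<Rightarrow> ('t \<Rightarrow> 'v set) \<Rightarrow> bool" where
  "tree_decomposition G T V \<longleftrightarrow> tree_graph T \<and>
     (\<forall>t\<in>pverts T. V t \<subseteq> pverts G) \<and>
     pverts G = (\<Union>t\<in>pverts T. V t) \<and>
     (\<forall>(i, j)\<in>parcs G. \<exists>t\<in>pverts T. i \<in> V t \<and> j \<in> V t) \<and>
     (\<forall>p. vpath p (with_proj T) \<longrightarrow> (\<forall>t\<in>set p. V (hd p) \<inter> V (last p) \<subseteq> V t))"

text \<open>
  The subtraction on \<open>nat\<close> is harmless for graphs with at least one vertex. Since trees are
  finite, it is no restriction to take natural numbers as tree nodes below.
\<close>

definition decomposition_width :: "'t pair_pre_digraph \<Rightarrow> ('t \<Rightarrow> 'v set) \<Rightarrow> nat" where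
  "decomposition_width T V = Max ((\<lambda>t. card (V t)) ` pverts T) - 1"

definition treewidth :: "'v pair_pre_digraph \<Rightarrow> nat" where
  "treewidth G = (LEAST w. \<exists>(T :: nat pair_pre_digraph) V.
     tree_decomposition G T V \<and> decomposition_width T V = w)"

definition pathwidth :: "'v pair_pre_digraph \<Rightarrow> nat" where
  "pathwidth G = (LEAST w. \<exists>(T :: nat pair_pre_digraph) V.
     tree_decomposition G T V \<and> path_graph T \<and> decomposition_width T V = w)"

section \<open>Real symmetric matrices\<close>

definition sym_mats :: "nat \<Rightarrow> real mat set" where
  "sym_mats n = {X \<in> carrier_mat n n. transpose_mat X = X}"

definition psd_mats :: "nat \<Rightarrow> real mat set" where
  "psd_mats n = {X \<in> sym_mats n. \<forall>v\<in>carrier_vec n. v \<bullet> (X *\<^sub>v v) \<ge> 0}"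

definition trace_inner :: "real mat \<Rightarrow> real mat \<Rightarrow> real" where
  "trace_inner A B = (\<Sum>i<dim_col A. (transpose_mat A * B) $$ (i, i))"

definition sparse_sym_mats :: "nat \<Rightarrow> nat pair_pre_digraph \<Rightarrow> real mat set" where
  "sparse_sym_mats n G =
     {X \<in> sym_mats n. \<forall>i<n. \<forall>j<n. i \<noteq> j \<and> (i, j) \<notin> parcs G \<longrightarrow> X $$ (i, j) = 0}"

abbreviation mat_rank :: "real mat \<Rightarrow> nat" where
  "mat_rank A \<equiv> vec_space.rank (dim_row A) A"

section \<open>Semidefinite programs\<close>

text \<open>
  \<open>sdp_coeff P 0\<close> is the objective matrix $A_0$; the constraints are numbered
  \<open>1, \<dots>, sdp_num P\<close>.
\<close>

record sdp =
  sdp_num :: nat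
  sdp_coeff :: "nat \<Rightarrow> real mat"
  sdp_lower :: "nat \<Rightarrow> ereal"
  sdp_upper :: "nat \<Rightarrow> ereal"

definition sdp_problem :: "nat \<Rightarrow> sdp \<Rightarrow> bool" where
  "sdp_problem n P \<longleftrightarrow> (\<forall>i\<le>sdp_num P. sdp_coeff P i \<in> sym_mats n) \<and>
     (\<forall>i\<in>{1..sdp_num P}. - \<infinity> \<le> sdp_lower P i \<and> sdp_lower P i \<le> sdp_upper P i \<and> sdp_upper P i < \<infinity>)"

definition sdp_feasible :: "nat \<Rightarrow> sdp \<Rightarrow> real mat set" where
  "sdp_feasible n P = {X \<in> psd_mats n. \<forall>i\<in>{1..sdp_num P}.
     sdp_lower P i \<le> ereal (trace_inner (sdp_coeff P i) X) \<and>
     ereal (trace_inner (sdp_coeff P i) X) \<le> sdp_upper P i}"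

definition sdp_optimal :: "nat \<Rightarrow> sdp \<Rightarrow> real mat set" where
  "sdp_optimal n P = {X \<in> sdp_feasible n P. \<forall>Y\<in>sdp_feasible n P.
     trace_inner (sdp_coeff P 0) X \<le> trace_inner (sdp_coeff P 0) Y}"

text \<open>\<open>L i\<close> is $A_i^l$; the matrix whose rank is bounded is $[A_0^l, \dots, A_m^l]$.\<close>

definition splr :: "nat \<Rightarrow> nat pair_pre_digraph \<Rightarrow> nat \<Rightarrow> sdp \<Rightarrow> bool" where
  "splr n G l P \<longleftrightarrow> (\<exists>S L. (\<forall>i\<le>sdp_num P.
       S i \<in> sparse_sym_mats n G \<and> L i \<in> carrier_mat n n \<and> sdp_coeff P i = S i + L i) \<and>
     mat_rank (mat_of_cols n (concat (map (\<lambda>i. cols (L i)) [0..<Suc (sdp_num P)]))) \<le> l)"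

section \<open>The function $\varphi$\<close>

definition phi_set :: "nat \<Rightarrow> real mat \<Rightarrow> real mat \<Rightarrow> real mat set" where
  "phi_set l U M = {Y \<in> psd_mats (2 * l).
     transpose_mat U * Y * U = M \<and>
     mat l l (\<lambda>(i, j). Y $$ (i, j)) = 1\<^sub>m l \<and>
     mat l l (\<lambda>(i, j). Y $$ (l + i, l + j)) = 1\<^sub>m l}"

definition phi :: "nat \<Rightarrow> nat" where
  "phi l = (if l = 0 then 0 else
     (LEAST r. \<forall>U\<in>carrier_mat (2 * l) l. \<forall>M\<in>sym_mats l.
        phi_set l U M = {} \<or> (\<exists>Y\<in>phi_set l U M. mat_rank Y \<le> r)))"

end

theory Submission
  imports Defs "Jordan_Normal_Form.Char_Poly"
begin

text \<open>
  (i) Let \<open>G\<close> join \<open>\<omega>\<close> universal vertices to all others. Together with matrices whose range lies in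
  the \<open>l\<close>-dimensional span of the differences $e_i - e_j$ of \<open>l + 1\<close> further vertices, the sparse
  matrices span all symmetric matrices on \<open>\<omega> + l + 1\<close> vertices, so that block of \<open>X\<close> can be
  prescribed to be the identity.

  (ii) Let \<open>U, M\<close> be extremal data for \<open>phi l\<close>. By lower semicontinuity of the rank both \<open>l \<times> l\<close>
  blocks $U_1, U_2$ of \<open>U\<close> may be taken invertible. Take a clique \<open>C\<close> of \<open>\<omega> + 1\<close> vertices with disjoint
  \<open>l\<close>-subsets $C_1, C_2, C_3$ and further \<open>l\<close>-sets $P_1, P_2, P_3$, the bags being \<open>C\<close> and
  $(C - C_k) + P_k$, arranged as a star with centre \<open>C\<close>. Prescribe on this pattern the
  entries of a matrix with identity blocks on \<open>C\<close>, $P_1$, $P_2$, the block \<open>M\<close> on $P_3$, and zeros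
  between \<open>C\<close> and $P_k$. A single constraint of rank \<open>l\<close> forces the Gram vectors of a feasible \<open>X\<close>
  to satisfy $P_1 U_1 + P_2 U_2 + P_3 = 0$. Comparing with the clique, $P_1$ and $P_2$ are orthogonal
  to \<open>C\<close>, and comparing with $P_3$, their Gram matrix lies in \<open>phi_set l U M\<close>. Hence the rank of \<open>X\<close>
  is at least \<open>(\<omega> + 1) + phi l\<close>.
\<close>

section \<open>Tree decompositions\<close>

text \<open>Node \<open>0\<close> is the root and each edge occurs in both directions. Under
  \<open>par i < i\<close> this is a tree; the constant function \<open>0\<close> gives a star and
  the predecessor function a path.\<close>

definition parent_tree :: "nat \<Rightarrow> (nat \<Rightarrow> nat) \<Rightarrow> nat pair_pre_digraph" where
  "parent_tree k par = \<lparr> pverts = {..<k},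
     parcs = {(i, j). i < k \<and> j < k \<and> (0 < i \<and> j = par i \<or> 0 < j \<and> i = par j)} \<rparr>"

text \<open>The largest graph whose edges are covered by the bags \<open>V t\<close>. Every bag is a
  clique in it, so a bag of maximal size certifies the treewidth from below.\<close>

definition bag_graph :: "nat \<Rightarrow> nat \<Rightarrow> (nat \<Rightarrow> nat set) \<Rightarrow> nat pair_pre_digraph" where
  "bag_graph n k V = \<lparr> pverts = {..<n},
     parcs = {(i, j). i < n \<and> j < n \<and> i \<noteq> j \<and> (\<exists>t<k. i \<in> V t \<and> j \<in> V t)} \<rparr>"

lemma pair_graphI:
  assumes "finite (pverts G)" "parcs G \<subseteq> pverts G \<times> pverts G"
    "sym (parcs G)" "\<And>x. (x, x) \<notin> parcs G"
  shows "pair_graph G"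
proof -
  have "finite (parcs G)"
    using assms by (meson finite_SigmaI finite_subset)
  with assms show ?thesis
    by unfold_locales (auto simp: symmetric_def)
qed

lemma graph_on_bag_graph: "graph_on n (bag_graph n k V)"
  unfolding graph_on_def bag_graph_def
  by (auto intro!: pair_graphI symI)

lemma pair_graph_parent_tree:
  assumes "\<And>i. 0 < i \<Longrightarrow> i < k \<Longrightarrow> par i < i"
  shows "pair_graph (parent_tree k par)"
proof -
  have "i \<noteq> par i" if "0 < i" "i < k" for i using assms[OF that] by simp
  then show ?thesis by (intro pair_graphI) (auto simp: parent_tree_def intro!: symI)
qed

lemma vwalk_arcs_nth:
  "Suc i < length p \<Longrightarrow> (p ! i, p ! Suc i) \<in> set (vwalk_arcs p)"
  by (induction p arbitrary: i rule: vwalk_arcs.induct) (auto simp: less_Suc_eq_0_disj)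

lemma vpath_nth_arc:
  assumes "vpath p (with_proj T)" "Suc i < length p"
  shows "(p ! i, p ! Suc i) \<in> parcs T"
  using vwalk_arcs_nth[OF assms(2)] assms(1) by (auto simp: vpath_def vwalk_def)

text \<open>Passing to the parent decreases the number of the node, so every node reaches the root
  \<open>0\<close>; by symmetry of the closure any two nodes are joined through the root.\<close>

lemma connected_parent_tree:
  assumes "k > 0" and par: "\<And>i. 0 < i \<Longrightarrow> i < k \<Longrightarrow> par i < i"
  shows "connected (with_proj (parent_tree k par))"
proof -
  let ?T = "with_proj (parent_tree k par)"
  have *: "(i, 0) \<in> rtrancl_on (verts ?T) ((arcs_ends ?T)\<^sup>s)" if "i < k" for i
    using that
  proof (induction i rule: less_induct)
    case (less i)
    show ?case
    proof (cases "i = 0")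
      case True
      with \<open>k > 0\<close> show ?thesis by (auto simp: parent_tree_def)
    next
      case False
      then have "par i < i" using par less by auto
      moreover have "(i, par i) \<in> (arcs_ends ?T)\<^sup>s"
        using False less \<open>par i < i\<close> by (auto simp: parent_tree_def symcl_def)
      moreover have "i \<in> verts ?T" using less by (auto simp: parent_tree_def)
      ultimately show ?thesis
        using less by (meson converse_rtrancl_on_into_rtrancl_on order_less_trans)
    qed
  qed
  have sym: "sym (rtrancl_on (verts ?T) ((arcs_ends ?T)\<^sup>s))"
    by (intro rtrancl_on_sym) (auto simp: symcl_def sym_def)
  have "(u, v) \<in> rtrancl_on (verts ?T) ((arcs_ends ?T)\<^sup>s)"
    if "u < k" "v < k" for u v
    using *[OF that(1)] symD[OF sym *[OF that(2)]] by (rule rtrancl_on_trans)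
  then show ?thesis
    using \<open>k > 0\<close> by (auto simp: connected_conv parent_tree_def)
qed

lemma tree_graph_parent_tree:
  assumes "k > 0" and par: "\<And>i. 0 < i \<Longrightarrow> i < k \<Longrightarrow> par i < i"
  shows "tree_graph (parent_tree k par)"
  unfolding tree_graph_def
proof (intro conjI notI)
  show "pair_graph (parent_tree k par)" using par by (rule pair_graph_parent_tree)
  show "connected (with_proj (parent_tree k par))" using assms by (rule connected_parent_tree)
next
  assume "\<exists>p. vpath p (with_proj (parent_tree k par)) \<and> 3 \<le> length p \<and>
    (last p, hd p) \<in> parcs (parent_tree k par)"
  then obtain p where p: "vpath p (with_proj (parent_tree k par))" "3 \<le> length p"
    and closed: "(last p, hd p) \<in> parcs (parent_tree k par)" by blast
  let ?len = "length p"
  have dist: "distinct p" using p by auto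
  have step: "(p ! i, p ! (Suc i mod ?len)) \<in> parcs (parent_tree k par)" if "i < ?len" for i
  proof (cases "Suc i < ?len")
    case True
    with vpath_nth_arc[OF p(1) True] show ?thesis by simp
  next
    case False
    with that have "i = ?len - 1" "Suc i = ?len" by auto
    moreover have "p \<noteq> []" using p(2) by auto
    ultimately show ?thesis
      using closed by (simp add: last_conv_nth hd_conv_nth)
  qed
  \<comment> \<open>An edge can only descend to the parent: the opposite reading would give
    \<open>a = par b\<close> with \<open>b < a\<close>, against \<open>par b < b\<close>.\<close>
  have down: "b = par a" if "(a, b) \<in> parcs (parent_tree k par) \<or> (b, a) \<in> parcs (parent_tree k par)" "b < a" for a b
    using that par[of b] by (auto simp: parent_tree_def)
  \<comment> \<open>The two neighbours on the cycle of its largest node would both be the parent of that node.\<close>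
  obtain i where i: "i < ?len" "p ! i = Max (set p)"
    using p(2) by (metis List.finite_set Max_in in_set_conv_nth list.size(3) not_numeral_le_zero set_empty)
  have max: "p ! j < p ! i" if "j < ?len" "j \<noteq> i" for j
  proof -
    have "p ! j \<le> p ! i" using i that by simp
    moreover have "p ! j \<noteq> p ! i" using dist that i nth_eq_iff_index_eq by blast
    ultimately show ?thesis by simp
  qed
  let ?s = "Suc i mod ?len" and ?q = "(if i = 0 then ?len - 1 else i - 1)"
  have s: "?s < ?len" "?s \<noteq> i"
    using p(2) i by (auto simp: mod_Suc)
  have q: "?q < ?len" "?q \<noteq> i" "Suc ?q mod ?len = i"
    using p(2) i by (auto simp: mod_Suc)
  \<comment> \<open>On a cycle of at least three nodes, successor and predecessor have different
    indices; an edge traversed back and forth is excluded here.\<close>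
  have "?s \<noteq> ?q" using p(2) i by (auto simp: mod_Suc)
  moreover have "p ! ?s = par (p ! i)"
    using down[of "p ! i" "p ! ?s"] step[OF i(1)] max[OF s] by blast
  moreover have "p ! ?q = par (p ! i)"
    using down[of "p ! i" "p ! ?q"] step[OF q(1)] q(3) max[OF q(1,2)] by metis
  ultimately show False
    using nth_eq_iff_index_eq[OF dist s(1) q(1)] by simp
qed

text \<open>The edge condition holds by construction of \<open>bag_graph\<close>, and the path
  condition is trivial at the ends of a path, so only interior nodes of paths with different ends
  remain to be checked.\<close>

lemma tree_decomposition_parent_tree:
  assumes "k > 0" and "\<And>i. 0 < i \<Longrightarrow> i < k \<Longrightarrow> par i < i"
    and "\<And>t. t < k \<Longrightarrow> V t \<subseteq> {..<n}" and "{..<n} \<subseteq> (\<Union>t<k. V t)"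
    and "\<And>p t. vpath p (with_proj (parent_tree k par)) \<Longrightarrow> t \<in> set p \<Longrightarrow> hd p \<noteq> last p \<Longrightarrow>
      t \<noteq> hd p \<Longrightarrow> t \<noteq> last p \<Longrightarrow> V (hd p) \<inter> V (last p) \<subseteq> V t"
  shows "tree_decomposition (bag_graph n k V) (parent_tree k par) V"
proof -
  have "V (hd p) \<inter> V (last p) \<subseteq> V t"
    if "vpath p (with_proj (parent_tree k par))" "t \<in> set p" for p t
  proof (cases "hd p = last p")
    case True
    \<comment> \<open>A path repeats no node, so equal ends leave a single node.\<close>
    with that have "p = [t]"
      by (cases p) (auto simp: vpath_def split: if_splits)
    then show ?thesis by simp
  next
    case False
    with assms(5)[OF that False] show ?thesis by auto
  qed
  then show ?thesis
    using assms(3,4) tree_graph_parent_tree[OF assms(1,2)]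
    unfolding tree_decomposition_def by (fastforce simp: bag_graph_def parent_tree_def)
qed

text \<open>An interior leaf would have the centre as both of its neighbours, which a path without
  repetitions excludes.\<close>

lemma star_tree_interior:
  assumes p: "vpath p (with_proj (parent_tree k (\<lambda>_. 0)))" and "t \<in> set p" "t \<noteq> hd p" "t \<noteq> last p"
  shows "t = 0"
proof (rule ccontr)
  assume "t \<noteq> 0"
  obtain i where i: "i < length p" "p ! i = t" using assms by (auto simp: in_set_conv_nth)
  have "i \<noteq> 0" using assms i by (metis hd_conv_nth length_0_conv less_nat_zero_code)
  moreover have "i \<noteq> length p - 1" using assms i by (metis last_conv_nth length_0_conv less_nat_zero_code)
  ultimately have j: "Suc (i - 1) = i" "Suc i < length p" using i by auto
  have "p ! (i - 1) = 0"
    using vpath_nth_arc[OF p, of "i - 1"] j i \<open>t \<noteq> 0\<close> by (auto simp: parent_tree_def)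
  moreover have "p ! Suc i = 0"
    using vpath_nth_arc[OF p, of i] j i \<open>t \<noteq> 0\<close> by (auto simp: parent_tree_def)
  moreover have "distinct p" using p by auto
  ultimately show False
    using j i nth_eq_iff_index_eq[of p "i - 1" "Suc i"] by auto
qed

lemma vwalk_arcs_upt: "set (vwalk_arcs [0..<k]) = {(i, Suc i) | i. Suc i < k}"
proof (induction k)
  case (Suc k)
  show ?case
  proof (cases "k = 0")
    case False
    then have "set (vwalk_arcs [0..<Suc k]) = insert (k - 1, k) (set (vwalk_arcs [0..<k]))"
      by (simp add: set_vwalk_arcs_snoc last_upt)
    with Suc False show ?thesis by (auto simp: less_Suc_eq)
  qed auto
qed auto

lemma path_graph_parent_tree:
  assumes "k > 0"
  shows "path_graph (parent_tree k (\<lambda>i. i - 1))"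
  unfolding path_graph_def
  by (rule exI[of _ "[0..<k]"])
    (use assms in \<open>auto simp: parent_tree_def vwalk_arcs_upt gr0_conv_Suc\<close>)

text \<open>Take a bag that contains as many elements of the clique as possible. If it misses \<open>v\<close>, the
  first bag with \<open>v\<close> on a path from there separates it from all other bags with \<open>v\<close>, so it
  contains \<open>v\<close> together with every clique element of the given bag.\<close>

lemma clique_in_bag:
  assumes td: "tree_decomposition G T V" and "finite K" "K \<subseteq> pverts G"
    and clique: "\<And>i j. i \<in> K \<Longrightarrow> j \<in> K \<Longrightarrow> i \<noteq> j \<Longrightarrow> (i, j) \<in> parcs G"
  shows "\<exists>t\<in>pverts T. K \<subseteq> V t"
proof -
  have T: "pair_graph T" "connected (with_proj T)"
    using td by (auto simp: tree_decomposition_def tree_graph_def)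
  interpret T: pair_graph T by fact
  have sc: "strongly_connected (with_proj T)"
    using T.symmetric_connected_imp_strongly_connected T.sym_arcs T(2) by blast
  have conn: "\<exists>p. vpath p (with_proj T) \<and> hd p = a \<and> last p = b"
    if "a \<in> pverts T" "b \<in> pverts T" for a b
    using sc that T.reachable_vpath_conv by (auto simp: strongly_connected_def)
  have bagp: "V (hd p) \<inter> V (last p) \<subseteq> V t" if "vpath p (with_proj T)" "t \<in> set p" for p t
    using td that by (auto simp: tree_decomposition_def)
  have finT: "finite (pverts T)" "pverts T \<noteq> {}"
    using T.pair_finite_verts sc by (auto simp: strongly_connected_def)
  have pair: "\<exists>r\<in>pverts T. u \<in> V r \<and> v \<in> V r" if "u \<in> K" "v \<in> K" for u v
  proof (cases "u = v")
    case True
    with that \<open>K \<subseteq> pverts G\<close> td show ?thesis by (auto simp: tree_decomposition_def)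
  next
    case False
    with clique[OF that False] td show ?thesis by (auto simp: tree_decomposition_def)
  qed
  obtain t where t: "t \<in> pverts T" and tmax: "\<And>s. s \<in> pverts T \<Longrightarrow> card (V s \<inter> K) \<le> card (V t \<inter> K)"
  proof -
    let ?m = "Max ((\<lambda>t. card (V t \<inter> K)) ` pverts T)"
    have "?m \<in> (\<lambda>t. card (V t \<inter> K)) ` pverts T" using finT by (intro Max_in) auto
    then obtain t where "t \<in> pverts T" "card (V t \<inter> K) = ?m" by auto
    then show ?thesis using that[of t] finT by simp
  qed
  have "K \<subseteq> V t"
  proof (rule ccontr)
    assume "\<not> K \<subseteq> V t"
    then obtain v where v: "v \<in> K" "v \<notin> V t" by blast
    obtain r0 where r0: "r0 \<in> pverts T" "v \<in> V r0" using pair[OF v(1) v(1)] by blast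
    obtain p where p: "vpath p (with_proj T)" "hd p = t" "last p = r0" using conn[OF t r0(1)] by blast
    have "r0 \<in> set p" using p by (auto simp: vpath_def vwalk_def)
    with r0 obtain a s b where p_eq: "p = a @ s # b" and s: "v \<in> V s" and a: "\<forall>x\<in>set a. v \<notin> V x"
      using split_list_first_prop[of p "\<lambda>x. v \<in> V x"] by blast
    have "a \<noteq> []" using p v s p_eq by auto
    have sT: "s \<in> pverts T" using p p_eq by (auto simp: vpath_def vwalk_def)
    have as: "vwalk (a @ [s]) (with_proj T)"
      by (rule vwalkI_append_l[of _ b]) (use p p_eq in \<open>simp_all add: vpath_def\<close>)
    have sub: "V t \<inter> K \<subseteq> V s"
    proof
      fix u assume u: "u \<in> V t \<inter> K"
      obtain r where r: "r \<in> pverts T" "u \<in> V r" "v \<in> V r" using pair u v by blast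
      obtain q where q: "vpath q (with_proj T)" "hd q = s" "last q = r" using conn[OF sT r(1)] by blast
      have qv: "v \<in> V x" if "x \<in> set q" for x using bagp[OF q(1) that] q s r by auto
      obtain q' where q': "q = s # q'" using q by (cases q) (auto simp: vpath_def vwalk_def)
      have "vwalk (a @ q) (with_proj T)"
      proof -
        have "set (vwalk_arcs (a @ q)) \<subseteq> parcs T"
          using as q \<open>a \<noteq> []\<close> by (auto simp: vpath_def vwalk_def vwalk_arcs_append q')
        then show ?thesis using as q by (auto simp: vpath_def vwalk_def)
      qed
      \<comment> \<open>Bags along \<open>a\<close> miss \<open>v\<close> and bags along
        \<open>q\<close> contain it, so the two pieces share no node.\<close>
      moreover have "distinct (a @ q)"
        using p p_eq q qv a by (auto simp: vpath_def)
      ultimately have "vpath (a @ q) (with_proj T)" by (rule vpathI)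
      from bagp[OF this, of s] have "V t \<inter> V r \<subseteq> V s"
        using q q' p p_eq \<open>a \<noteq> []\<close> by auto
      then show "u \<in> V s" using u r by blast
    qed
    have "insert v (V t \<inter> K) \<subseteq> V s \<inter> K" using sub s v by blast
    then have "card (insert v (V t \<inter> K)) \<le> card (V s \<inter> K)"
      using \<open>finite K\<close> by (intro card_mono) auto
    moreover have "card (insert v (V t \<inter> K)) = Suc (card (V t \<inter> K))"
      using \<open>finite K\<close> v by simp
    ultimately show False using tmax[OF sT] by simp
  qed
  then show ?thesis using t by blast
qed

lemma clique_le_decomposition_width:
  assumes td: "tree_decomposition G T V" and "finite (pverts G)" "K \<subseteq> pverts G"
    and "\<And>i j. i \<in> K \<Longrightarrow> j \<in> K \<Longrightarrow> i \<noteq> j \<Longrightarrow> (i, j) \<in> parcs G"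
  shows "card K - 1 \<le> decomposition_width T V"
proof -
  obtain t where t: "t \<in> pverts T" "K \<subseteq> V t"
    using clique_in_bag[OF td finite_subset[OF assms(3,2)] assms(3,4)] by blast
  have "finite (pverts T)"
    using td by (auto simp: tree_decomposition_def tree_graph_def pair_graph_def pair_digraph_def
        dest: pair_fin_digraph.pair_finite_verts)
  moreover have "finite (V t)"
    using td t assms(2) by (auto simp: tree_decomposition_def intro: finite_subset)
  then have "card K \<le> card (V t)" using t by (intro card_mono)
  ultimately have "card K \<le> Max ((\<lambda>t. card (V t)) ` pverts T)"
    using t by (meson Max_ge finite_imageI image_eqI le_trans)
  then show ?thesis by (simp add: decomposition_width_def)
qed

text \<open>The clique \<open>V 0\<close> of \<open>w + 1\<close> vertices bounds the width of every
  decomposition from below, and the given decomposition attains the bound.\<close>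

lemma bag_graph_width:
  assumes td: "tree_decomposition (bag_graph n k V) (parent_tree k par) V"
    and "k > 0" and bags: "\<And>t. t < k \<Longrightarrow> card (V t) \<le> Suc w" and "card (V 0) = Suc w"
  shows "treewidth (bag_graph n k V) = w"
    and "path_graph (parent_tree k par) \<Longrightarrow> pathwidth (bag_graph n k V) = w"
proof -
  let ?G = "bag_graph n k V" and ?T = "parent_tree k par"
  have "Max ((\<lambda>t. card (V t)) ` {..<k}) = Suc w"
    using assms by (intro Max_eqI) (auto intro: rev_image_eqI)
  then have width: "decomposition_width ?T V = w"
    by (simp add: decomposition_width_def parent_tree_def)
  have V0: "V 0 \<subseteq> {..<n}"
    using td \<open>k > 0\<close> by (auto simp: tree_decomposition_def parent_tree_def bag_graph_def)
  have lower: "w \<le> decomposition_width T V'" if "tree_decomposition ?G T V'"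
    for T :: "nat pair_pre_digraph" and V'
    using clique_le_decomposition_width[OF that, of "V 0"] V0 \<open>k > 0\<close> \<open>card (V 0) = Suc w\<close>
    by (auto simp: bag_graph_def)
  show "treewidth ?G = w"
    unfolding treewidth_def by (rule Least_equality) (use td width lower in blast)+
  show "pathwidth ?G = w" if "path_graph ?T"
    unfolding pathwidth_def by (rule Least_equality) (use td width lower that in blast)+
qed

section \<open>Rank of a matrix\<close>

lemma mat_mult_unit_vec:
  fixes A :: "'a :: semiring_1 mat"
  assumes "A \<in> carrier_mat n m" "j < m"
  shows "A *\<^sub>v unit_vec m j = col A j"
  using assms by (intro eq_vecI) auto

context vec_space
begin

lemma rank_le_if_cols_in_span:
  assumes A: "A \<in> carrier_mat n p" and B: "B \<in> carrier_mat n q"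
    and sub: "set (cols A) \<subseteq> span (set (cols B))"
  shows "rank A \<le> rank B"
proof -
  have cA: "set (cols A) \<subseteq> carrier_vec n" and cB: "set (cols B) \<subseteq> carrier_vec n"
    using A B cols_dim by blast+
  have sA: "VectorSpace.subspace class_ring (span (set (cols A))) V"
    and sB: "VectorSpace.subspace class_ring (span (set (cols B))) V"
    using span_is_subspace cA cB by auto
  have "span (set (cols A)) \<subseteq> span (set (cols B))"
    using span_subsetI[OF cB sub] .
  then have "VectorSpace.subspace class_ring (span (set (cols A))) (vs (span (set (cols B))))"
    by (rule nested_subspaces[OF sB sA])
  then show ?thesis
    unfolding rank_def
    using vectorspace.subspace_dim[OF subspace_is_vs[OF sB]] fin_dim_span_cols[OF A] fin_dim_span_cols[OF B]
    by auto
qed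

lemma rank_mult_le:
  assumes A: "A \<in> carrier_mat n p" and B: "B \<in> carrier_mat p q"
  shows "rank (A * B) \<le> rank A"
proof (rule rank_le_if_cols_in_span[OF mult_carrier_mat[OF A B] A])
  show "set (cols (A * B)) \<subseteq> span (set (cols A))"
  proof
    fix v assume "v \<in> set (cols (A * B))"
    then obtain j where "j < q" "v = col (A * B) j"
      using A B by (auto simp: cols_def)
    then have "v = A *\<^sub>v col B j" using col_mult2[OF A B] by metis
    moreover have "col B j \<in> carrier_vec p" using B by auto
    ultimately have "v \<in> col_space A" unfolding col_space_eq[OF A] using A by auto
    then show "v \<in> span (set (cols A))" by (simp add: col_space_def)
  qed
qed

lemma rank_eq_if_trivial_kernel:
  assumes C: "C \<in> carrier_mat n r"
    and ker: "\<And>x. x \<in> carrier_vec r \<Longrightarrow> C *\<^sub>v x = 0\<^sub>v n \<Longrightarrow> x = 0\<^sub>v r"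
  shows "rank C = r"
proof -
  have dist: "distinct (cols C)"
  proof (rule ccontr)
    assume "\<not> distinct (cols C)"
    then obtain i j where ij: "i < r" "j < r" "i \<noteq> j" "col C i = col C j"
      using C by (auto simp: distinct_conv_nth)
    \<comment> \<open>The rank refers to the set of columns, so coinciding columns are excluded
      separately: they would put this nonzero vector into the kernel.\<close>
    let ?x = "unit_vec r i - unit_vec r j :: 'a vec"
    have "C *\<^sub>v ?x = C *\<^sub>v unit_vec r i - C *\<^sub>v unit_vec r j"
      using C by (intro mult_minus_distrib_mat_vec) auto
    also have "\<dots> = 0\<^sub>v n"
      using C ij by (simp add: mat_mult_unit_vec[OF C])
    finally have "?x = 0\<^sub>v r" using ker[of ?x] by auto
    then have "?x $ i = 0" using ij by simp
    then show False using ij by simp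
  qed
  moreover have "lin_indpt (set (cols C))"
    using lin_depE[OF C _ dist] ker by metis
  ultimately show ?thesis using lin_indpt_full_rank[OF C] by blast
qed

text \<open>An existential form of the rank bound: a witness \<open>B\<close> can be enlarged by
  blocks or kept fixed along a limit, which is how later rank bounds are transferred. From left to
  right \<open>B\<close> selects \<open>r\<close> independent columns of \<open>A\<close>;
  conversely \<open>A * B\<close> has full column rank.\<close>

lemma rank_ge_iff:
  assumes A: "A \<in> carrier_mat n m"
  shows "r \<le> rank A \<longleftrightarrow>
    (\<exists>B\<in>carrier_mat m r. \<forall>x\<in>carrier_vec r. A *\<^sub>v (B *\<^sub>v x) = 0\<^sub>v n \<longrightarrow> x = 0\<^sub>v r)"
proof
  assume "r \<le> rank A"
  obtain S where S: "maximal S (\<lambda>T. T \<subseteq> set (cols A) \<and> lin_indpt T)"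
    using maximal_exists[of "(\<lambda>T. T \<subseteq> set (cols A) \<and> lin_indpt T)" "card (set (cols A))" "{}"]
    by (meson List.finite_set card_mono empty_iff empty_subsetI finite_lin_indpt2 rev_finite_subset)
  have S': "S \<subseteq> set (cols A)" "lin_indpt S" "finite S"
    using S by (auto simp: maximal_def intro: finite_subset)
  have "card S = rank A" using rank_card_indpt[OF A S] by simp
  with \<open>r \<le> rank A\<close> obtain T where T: "T \<subseteq> S" "card T = r"
    using obtain_subset_with_card_n by metis
  then have "finite T" using S'(3) finite_subset by blast
  then obtain ts where ts: "set ts = T" "distinct ts" using finite_distinct_list by blast
  have len: "length ts = r" using ts T distinct_card by fastforce
  have "T \<subseteq> set (cols A)" using T S' by blast
  then have "\<forall>k<r. \<exists>j<m. col A j = ts ! k"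
    using A len ts(1) by (force simp: cols_def dest: nth_mem)
  then obtain f where f: "\<And>k. k < r \<Longrightarrow> f k < m \<and> col A (f k) = ts ! k" by metis
  define B :: "'a mat" where "B = mat_of_cols m (map (\<lambda>k. unit_vec m (f k)) [0..<r])"
  have B: "B \<in> carrier_mat m r" by (auto simp: B_def mat_of_cols_def)
  have tsn: "set ts \<subseteq> carrier_vec n" using ts(1) \<open>T \<subseteq> set (cols A)\<close> A cols_dim by blast
  have AB: "A * B = mat_of_cols n ts"
  proof (rule mat_col_eqI)
    fix k assume "k < dim_col (mat_of_cols n ts)"
    then have k: "k < r" using len by simp
    have "col B k = unit_vec m (f k)" using k by (simp add: B_def col_mat_of_cols)
    then have "col (A * B) k = ts ! k"
      using f[OF k] col_mult2[OF A B k] mat_mult_unit_vec[OF A] by simp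
    then show "col (A * B) k = col (mat_of_cols n ts) k"
      using k len tsn by (simp add: col_mat_of_cols subset_iff)
  qed (use A B len in auto)
  have li: "lin_indpt (set ts)"
    using subset_li_is_li[OF S'(2)] T ts by blast
  show "\<exists>B\<in>carrier_mat m r. \<forall>x\<in>carrier_vec r. A *\<^sub>v (B *\<^sub>v x) = 0\<^sub>v n \<longrightarrow> x = 0\<^sub>v r"
  proof (intro bexI[OF _ B] ballI impI)
    fix x :: "'a vec" assume x: "x \<in> carrier_vec r" and "A *\<^sub>v (B *\<^sub>v x) = 0\<^sub>v n"
    then have "mat_of_cols n ts *\<^sub>v x = 0\<^sub>v n"
      using AB A B by (simp flip: assoc_mult_mat_vec)
    then show "x = 0\<^sub>v r"
      using lin_depI[of "mat_of_cols n ts" r x] x len li ts(2) cols_mat_of_cols[OF tsn]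
      by (auto simp: mat_of_cols_def)
  qed
next
  assume "\<exists>B\<in>carrier_mat m r. \<forall>x\<in>carrier_vec r. A *\<^sub>v (B *\<^sub>v x) = 0\<^sub>v n \<longrightarrow> x = 0\<^sub>v r"
  then obtain B where B: "B \<in> carrier_mat m r"
    and ker: "\<And>x. x \<in> carrier_vec r \<Longrightarrow> A *\<^sub>v (B *\<^sub>v x) = 0\<^sub>v n \<Longrightarrow> x = 0\<^sub>v r" by blast
  have "rank (A * B) = r"
    using A B ker by (intro rank_eq_if_trivial_kernel) (auto simp: assoc_mult_mat_vec[OF A B])
  then show "r \<le> rank A" using rank_mult_le[OF A B] by simp
qed

end

lemma mat_rank_ge_iff:
  assumes "A \<in> carrier_mat n m"
  shows "r \<le> mat_rank A \<longleftrightarrow>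
    (\<exists>B\<in>carrier_mat m r. \<forall>x\<in>carrier_vec r. A *\<^sub>v (B *\<^sub>v x) = 0\<^sub>v n \<longrightarrow> x = 0\<^sub>v r)"
  using vec_space.rank_ge_iff[OF assms] assms by auto

lemma mat_rank_le_if_cols_in_range:
  fixes A :: "real mat"
  assumes A: "A \<in> carrier_mat n p" and F: "F \<in> carrier_mat n q"
    and cols: "\<And>j. j < p \<Longrightarrow> \<exists>x\<in>carrier_vec q. col A j = F *\<^sub>v x"
  shows "mat_rank A \<le> q"
proof -
  interpret vec_space "TYPE(real)" n .
  have "set (cols A) \<subseteq> col_space F"
    unfolding col_space_eq[OF F] using A F cols by (force simp: cols_def)
  then have "rank A \<le> rank F"
    using rank_le_if_cols_in_span[OF A F] by (simp add: col_space_def)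
  then show ?thesis using rank_le_nc[OF F] A by simp
qed

lemma sum_two_blocks:
  fixes f :: "nat \<Rightarrow> 'a :: comm_monoid_add"
  assumes "c + k \<le> n" and "\<And>j. c + k \<le> j \<Longrightarrow> j < n \<Longrightarrow> f j = 0"
  shows "sum f {0..<n} = sum f {0..<c} + (\<Sum>j=0..<k. f (c + j))"
proof -
  have "sum f {0..<n} = sum f {0..<c + k} + sum f {c + k..<n}"
    using assms(1) by (simp add: sum.atLeastLessThan_concat)
  also have "sum f {c + k..<n} = 0" using assms(2) by (intro sum.neutral) auto
  also have "sum f {0..<c + k} = sum f {0..<c} + sum f {c..<c + k}"
    by (simp add: sum.atLeastLessThan_concat)
  also have "sum f {c..<c + k} = (\<Sum>j=0..<k. f (c + j))"
    using sum.shift_bounds_nat_ivl[of f 0 c k] by (simp add: add.commute)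
  finally show ?thesis by simp
qed

text \<open>The leading block of size \<open>c + k\<close> is the direct sum of an identity and
  \<open>Y\<close>; the rest of \<open>X\<close> is arbitrary. A witness supported on the leading
  coordinates multiplies the remaining columns by zero, and the remaining rows only add equations to
  the kernel condition.\<close>

lemma mat_rank_block_diag_ge:
  assumes X: "X \<in> carrier_mat n n" and Y: "Y \<in> carrier_mat k k" and "c + k \<le> n"
    and one: "\<And>i j. i < c \<Longrightarrow> j < c \<Longrightarrow> X $$ (i, j) = (if i = j then 1 else 0)"
    and zero: "\<And>i j. i < c \<Longrightarrow> j < k \<Longrightarrow> X $$ (i, c + j) = 0 \<and> X $$ (c + j, i) = 0"
    and YX: "\<And>i j. i < k \<Longrightarrow> j < k \<Longrightarrow> X $$ (c + i, c + j) = Y $$ (i, j)"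
  shows "c + mat_rank Y \<le> mat_rank X"
proof -
  let ?r = "mat_rank Y"
  obtain B where B: "B \<in> carrier_mat k ?r"
    and ker: "\<And>x. x \<in> carrier_vec ?r \<Longrightarrow> Y *\<^sub>v (B *\<^sub>v x) = 0\<^sub>v k \<Longrightarrow> x = 0\<^sub>v ?r"
    using mat_rank_ge_iff[OF Y, of ?r] by auto
  \<comment> \<open>The direct sum of the identity and the witness \<open>B\<close> for
    \<open>Y\<close>, padded with zero rows.\<close>
  define B' where "B' = mat n (c + ?r) (\<lambda>(i, j). if i < c then (if i = j then 1 else 0)
    else if i < c + k \<and> c \<le> j then B $$ (i - c, j - c) else 0)"
  have B': "B' \<in> carrier_mat n (c + ?r)" by (simp add: B'_def)
  have "x = 0\<^sub>v (c + ?r)" if x: "x \<in> carrier_vec (c + ?r)" and 0: "X *\<^sub>v (B' *\<^sub>v x) = 0\<^sub>v n" for x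
  proof -
    define x2 where "x2 = vec ?r (\<lambda>j. x $ (c + j))"
    have x2: "x2 \<in> carrier_vec ?r" by (simp add: x2_def)
    define w where "w = B' *\<^sub>v x"
    have w: "w \<in> carrier_vec n" using B' x unfolding w_def by (rule mult_mat_vec_carrier)
    have w1: "w $ i = x $ i" if "i < c" for i
    proof -
      have "w $ i = (\<Sum>j=0..<c + ?r. (if i = j then 1 else 0) * x $ j)"
        using that x \<open>c + k \<le> n\<close> unfolding w_def B'_def
        by (simp add: scalar_prod_def)
      also have "\<dots> = (\<Sum>j=0..<c + ?r. if i = j then x $ j else 0)"
        by (rule sum.cong) auto
      finally show ?thesis using that by simp
    qed
    have w2: "w $ (c + i) = (B *\<^sub>v x2) $ i" if "i < k" for i
    proof -
      have "w $ (c + i) = (\<Sum>j=0..<c + ?r. (if c \<le> j then B $$ (i, j - c) else 0) * x $ j)"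
        using that x \<open>c + k \<le> n\<close> unfolding w_def B'_def
        by (auto simp: scalar_prod_def intro!: sum.cong)
      also have "\<dots> = (\<Sum>j=0..<?r. B $$ (i, j) * x $ (c + j))"
        by (subst sum_two_blocks[of c ?r]) auto
      finally show ?thesis using that B by (auto simp: scalar_prod_def x2_def intro!: sum.cong)
    qed
    have w3: "w $ i = 0" if "c + k \<le> i" "i < n" for i
      using that x \<open>c + k \<le> n\<close> unfolding w_def B'_def by (auto simp: scalar_prod_def intro!: sum.neutral)
    have row: "(\<Sum>j=0..<c. X $$ (i, j) * w $ j) + (\<Sum>j=0..<k. X $$ (i, c + j) * w $ (c + j)) = 0" if "i < n" for i
    proof -
      have "(X *\<^sub>v w) $ i = 0" using 0 that by (simp add: w_def)
      then have "(\<Sum>j=0..<n. X $$ (i, j) * w $ j) = 0"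
        using that X w by (simp add: scalar_prod_def)
      then show ?thesis using w3 \<open>c + k \<le> n\<close> by (subst (asm) sum_two_blocks[of c k]) auto
    qed
    have x1: "x $ i = 0" if "i < c" for i
    proof -
      have "(\<Sum>j=0..<c. X $$ (i, j) * w $ j) = (\<Sum>j=0..<c. if i = j then w $ j else 0)"
        using one[OF that] by (intro sum.cong) auto
      with row[of i] that \<open>c + k \<le> n\<close> zero w1 show ?thesis by simp
    qed
    have "Y *\<^sub>v (B *\<^sub>v x2) = 0\<^sub>v k"
    proof (rule eq_vecI)
      fix i assume "i < dim_vec (0\<^sub>v k :: real vec)"
      then have i: "i < k" by simp
      have "(\<Sum>j=0..<k. Y $$ (i, j) * (B *\<^sub>v x2) $ j) = 0"
        using row[of "c + i"] i \<open>c + k \<le> n\<close> zero YX w2 by simp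
      then show "(Y *\<^sub>v (B *\<^sub>v x2)) $ i = 0\<^sub>v k $ i"
        using i Y B x2 by (simp add: scalar_prod_def)
    qed (use Y in simp)
    from ker[OF x2 this] have x2_0: "x $ (c + j) = 0" if "j < ?r" for j
      using that by (metis x2_def index_vec index_zero_vec(1))
    show ?thesis
    proof (rule eq_vecI)
      fix i assume "i < dim_vec (0\<^sub>v (c + ?r) :: real vec)"
      then show "x $ i = 0\<^sub>v (c + ?r) $ i"
        using x1[of i] x2_0[of "i - c"] by (cases "i < c") auto
    qed (use x in simp)
  qed
  then show ?thesis using mat_rank_ge_iff[OF X] B' by blast
qed

section \<open>Positive semidefinite matrices\<close>

lemma sym_matsD:
  assumes "X \<in> sym_mats n" "i < n" "j < n"
  shows "X $$ (j, i) = X $$ (i, j)"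
proof -
  have "X $$ (j, i) = X\<^sup>T $$ (j, i)" using assms by (simp add: sym_mats_def)
  also have "\<dots> = X $$ (i, j)" using assms by (intro index_transpose_mat) (auto simp: sym_mats_def)
  finally show ?thesis .
qed

lemma quadratic_form_add:
  fixes X :: "real mat"
  assumes X: "X \<in> sym_mats n" and u: "u \<in> carrier_vec n" and v: "v \<in> carrier_vec n"
  shows "(u + t \<cdot>\<^sub>v v) \<bullet> (X *\<^sub>v (u + t \<cdot>\<^sub>v v)) =
    u \<bullet> (X *\<^sub>v u) + 2 * t * (v \<bullet> (X *\<^sub>v u)) + t\<^sup>2 * (v \<bullet> (X *\<^sub>v v))"
proof -
  have Xc: "X \<in> carrier_mat n n" and XT: "X\<^sup>T = X" using X by (auto simp: sym_mats_def)
  have uv: "u \<bullet> (X *\<^sub>v v) = v \<bullet> (X *\<^sub>v u)"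
    using transpose_vec_mult_scalar[OF Xc u v] XT comm_scalar_prod[OF u mult_mat_vec_carrier[OF Xc v]] by simp
  have tv: "t \<cdot>\<^sub>v v \<in> carrier_vec n" and Xu: "X *\<^sub>v u \<in> carrier_vec n" and Xv: "X *\<^sub>v v \<in> carrier_vec n"
    using u v Xc by auto
  have Xuv: "X *\<^sub>v (u + t \<cdot>\<^sub>v v) = X *\<^sub>v u + t \<cdot>\<^sub>v (X *\<^sub>v v)"
    using mult_add_distrib_mat_vec[OF Xc u tv] mult_mat_vec[OF Xc v] by simp
  have "(u + t \<cdot>\<^sub>v v) \<bullet> w = u \<bullet> w + t * (v \<bullet> w)" if "w \<in> carrier_vec n" for w
    using add_scalar_prod_distrib[OF u tv that] v that by simp
  moreover have "w \<bullet> (X *\<^sub>v u + t \<cdot>\<^sub>v (X *\<^sub>v v)) = w \<bullet> (X *\<^sub>v u) + t * (w \<bullet> (X *\<^sub>v v))"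
    if "w \<in> carrier_vec n" for w
    using scalar_prod_add_distrib[OF that Xu smult_carrier_vec[THEN iffD2, OF Xv]] Xv that by simp
  ultimately show ?thesis
    using u v Xu Xv uv unfolding Xuv
    by (simp add: power2_eq_square distrib_left)
qed

lemma unit_vec_bilinear:
  fixes A :: "'a :: comm_semiring_1 mat"
  assumes A: "A \<in> carrier_mat n m" and "i < n" "j < m"
  shows "unit_vec n i \<bullet> (A *\<^sub>v unit_vec m j) = A $$ (i, j)"
  using assms scalar_prod_left_unit[of "col A j" n i] by (simp add: mat_mult_unit_vec[OF A])

text \<open>Positivity at the vectors e_i + e_j and e_i - e_j. A unit diagonal therefore bounds all
  entries by \<open>1\<close>, which gives the compactness used for \<open>phi_set\<close>.\<close>

lemma psd_entry_bound:
  assumes X: "X \<in> psd_mats n" and ij: "i < n" "j < n"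
  shows "\<bar>X $$ (i, j)\<bar> \<le> (X $$ (i, i) + X $$ (j, j)) / 2"
proof -
  have sym: "X \<in> sym_mats n" and Xc: "X \<in> carrier_mat n n"
    and nonneg: "\<And>v. v \<in> carrier_vec n \<Longrightarrow> 0 \<le> v \<bullet> (X *\<^sub>v v)"
    using X by (auto simp: psd_mats_def sym_mats_def)
  have "X $$ (j, i) = X $$ (i, j)"
    using sym_matsD[OF sym ij] .
  then have "0 \<le> X $$ (i, i) + 2 * t * X $$ (i, j) + t\<^sup>2 * X $$ (j, j)" for t
    using nonneg[of "unit_vec n i + t \<cdot>\<^sub>v unit_vec n j"] ij
    by (simp add: quadratic_form_add[OF sym] unit_vec_bilinear[OF Xc])
  from this[of 1] this[of "-1"] show ?thesis by simp
qed

lemma conjugate_real_vec: "conjugate v = (v :: real vec)"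
  by (intro eq_vecI) auto

text \<open>With \<open>g = X *\<^sub>v f\<close>, the form at
  \<open>f + t \<cdot>\<^sub>v g\<close> is a quadratic in \<open>t\<close> without constant term
  and with linear coefficient \<open>2 * (g \<bullet> g)\<close>; nonnegativity for all
  \<open>t\<close> forces \<open>g\<close> to vanish.\<close>

lemma psd_kernel:
  assumes X: "X \<in> psd_mats n" and f: "f \<in> carrier_vec n" and 0: "f \<bullet> (X *\<^sub>v f) = 0"
  shows "X *\<^sub>v f = 0\<^sub>v n"
proof -
  have sym: "X \<in> sym_mats n" and Xc: "X \<in> carrier_mat n n"
    and nonneg: "\<And>v. v \<in> carrier_vec n \<Longrightarrow> 0 \<le> v \<bullet> (X *\<^sub>v v)"
    using X by (auto simp: psd_mats_def sym_mats_def)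
  define g where "g = X *\<^sub>v f"
  have g: "g \<in> carrier_vec n" unfolding g_def using Xc f by (rule mult_mat_vec_carrier)
  define a b where "a = g \<bullet> g" and "b = g \<bullet> (X *\<^sub>v g)"
  have b: "0 \<le> b" using nonneg[OF g] by (simp add: b_def)
  have a: "0 \<le> a" by (simp add: a_def scalar_prod_def sum_nonneg)
  have "0 \<le> 2 * t * a + t\<^sup>2 * b" for t
    using nonneg[of "f + t \<cdot>\<^sub>v g"] f g 0
    by (simp add: quadratic_form_add[OF sym] a_def b_def flip: g_def)
  \<comment> \<open>The choice \<open>- a / b\<close> would minimise the quadratic; the denominator
    \<open>1 + b\<close> avoids a case distinction for \<open>b = 0\<close>.\<close>
  from this[of "- a / (1 + b)"] have "2 * (a / (1 + b)) * a \<le> (a / (1 + b))\<^sup>2 * b"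
    by (simp add: power_divide)
  also have "\<dots> = (a / (1 + b)) * a * (b / (1 + b))"
    by (simp add: power2_eq_square)
  also have "\<dots> \<le> (a / (1 + b)) * a * 1"
    using a b by (intro mult_left_mono) auto
  finally have "(a / (1 + b)) * a \<le> 0" by simp
  then have "a = 0"
    using a b by (auto simp: mult_le_0_iff divide_le_0_iff)
  then show ?thesis
    using conjugate_square_eq_0_vec[OF g] by (simp add: a_def conjugate_real_vec g_def)
qed

lemma congruence_sym:
  assumes Y: "Y \<in> sym_mats m" and K: "K \<in> carrier_mat m k"
  shows "K\<^sup>T * Y * K \<in> sym_mats k"
proof -
  have Yc: "Y \<in> carrier_mat m m" and YT: "Y\<^sup>T = Y" using Y by (auto simp: sym_mats_def)
  have KT: "K\<^sup>T \<in> carrier_mat k m" using K by simp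
  have "(K\<^sup>T * Y * K)\<^sup>T = K\<^sup>T * (K\<^sup>T * Y)\<^sup>T"
    using K Yc KT by (intro transpose_mult[of _ k m]) auto
  also have "(K\<^sup>T * Y)\<^sup>T = Y * K"
    using transpose_mult[OF KT Yc] YT by simp
  also have "K\<^sup>T * (Y * K) = K\<^sup>T * Y * K"
    using assoc_mult_mat[OF KT Yc K] by simp
  finally show ?thesis using K Yc KT by (simp add: sym_mats_def)
qed

lemma congruence_entry:
  fixes Y :: "real mat"
  assumes Y: "Y \<in> carrier_mat m m" and K: "K \<in> carrier_mat m k" and ij: "i < k" "j < k"
  shows "(K\<^sup>T * Y * K) $$ (i, j) = col K i \<bullet> (Y *\<^sub>v col K j)"
proof -
  have "K\<^sup>T * Y * K = K\<^sup>T * (Y * K)"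
    using K Y by (intro assoc_mult_mat) auto
  then have "(K\<^sup>T * Y * K) $$ (i, j) = row K\<^sup>T i \<bullet> col (Y * K) j"
    using K Y ij by simp
  also have "\<dots> = col K i \<bullet> (Y *\<^sub>v col K j)"
    using K ij col_mult2[OF Y K ij(2)] by simp
  finally show ?thesis .
qed

lemma congruence_quadratic:
  fixes Y :: "real mat"
  assumes Y: "Y \<in> carrier_mat m m" and K: "K \<in> carrier_mat m k" and v: "v \<in> carrier_vec k"
  shows "v \<bullet> ((K\<^sup>T * Y * K) *\<^sub>v v) = (K *\<^sub>v v) \<bullet> (Y *\<^sub>v (K *\<^sub>v v))"
proof -
  have KT: "K\<^sup>T \<in> carrier_mat k m" and Kv: "K *\<^sub>v v \<in> carrier_vec m" using K v by auto
  have YKv: "Y *\<^sub>v (K *\<^sub>v v) \<in> carrier_vec m" using Y Kv by (rule mult_mat_vec_carrier)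
  have "(K\<^sup>T * Y * K) *\<^sub>v v = K\<^sup>T *\<^sub>v (Y *\<^sub>v (K *\<^sub>v v))"
    using assoc_mult_mat_vec[OF mult_carrier_mat[OF KT Y] K v] assoc_mult_mat_vec[OF KT Y Kv] by simp
  then have "v \<bullet> ((K\<^sup>T * Y * K) *\<^sub>v v) = (K\<^sup>T *\<^sub>v (Y *\<^sub>v (K *\<^sub>v v))) \<bullet> v"
    using comm_scalar_prod[OF v mult_mat_vec_carrier[OF KT YKv]] by simp
  also have "\<dots> = (Y *\<^sub>v (K *\<^sub>v v)) \<bullet> (K *\<^sub>v v)"
    by (rule transpose_vec_mult_scalar[OF K v YKv])
  finally show ?thesis using comm_scalar_prod[OF Kv YKv] by simp
qed

lemma congruence_psd:
  assumes Y: "Y \<in> psd_mats m" and K: "K \<in> carrier_mat m k"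
  shows "K\<^sup>T * Y * K \<in> psd_mats k"
proof -
  have sym: "Y \<in> sym_mats m" and Yc: "Y \<in> carrier_mat m m"
    using Y by (auto simp: psd_mats_def sym_mats_def)
  show ?thesis
    using congruence_sym[OF sym K] congruence_quadratic[OF Yc K] Y mult_mat_vec_carrier[OF K]
    by (auto simp: psd_mats_def)
qed

lemma block_diag_one_quadratic:
  fixes Z :: "real mat"
  assumes Z: "Z \<in> carrier_mat k k" and u: "u \<in> carrier_vec c" and v: "v \<in> carrier_vec k"
  shows "(u @\<^sub>v v) \<bullet> (four_block_mat (1\<^sub>m c) (0\<^sub>m c k) (0\<^sub>m k c) Z *\<^sub>v (u @\<^sub>v v)) = u \<bullet> u + v \<bullet> (Z *\<^sub>v v)"
proof -
  have Zv: "Z *\<^sub>v v \<in> carrier_vec k" using Z v by (rule mult_mat_vec_carrier)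
  have "four_block_mat (1\<^sub>m c) (0\<^sub>m c k) (0\<^sub>m k c) Z *\<^sub>v (u @\<^sub>v v) =
    (1\<^sub>m c *\<^sub>v u + 0\<^sub>m c k *\<^sub>v v) @\<^sub>v (0\<^sub>m k c *\<^sub>v u + Z *\<^sub>v v)"
    by (rule four_block_mat_mult_vec[OF _ _ _ Z u v]) auto
  also have "\<dots> = u @\<^sub>v (Z *\<^sub>v v)"
  proof -
    have "0\<^sub>m c k *\<^sub>v v = 0\<^sub>v c" "0\<^sub>m k c *\<^sub>v u = 0\<^sub>v k"
      using u v by (auto intro!: eq_vecI)
    then show ?thesis using u Zv by simp
  qed
  finally show ?thesis using scalar_prod_append[OF u v u Zv] by simp
qed

lemma block_diag_one_psd:
  assumes Z: "Z \<in> psd_mats k"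
  shows "four_block_mat (1\<^sub>m c) (0\<^sub>m c k) (0\<^sub>m k c) Z \<in> psd_mats (c + k)"
proof -
  let ?D = "four_block_mat (1\<^sub>m c) (0\<^sub>m c k) (0\<^sub>m k c) Z"
  have Zc: "Z \<in> carrier_mat k k" and ZT: "Z\<^sup>T = Z"
    and nonneg: "\<And>v. v \<in> carrier_vec k \<Longrightarrow> 0 \<le> v \<bullet> (Z *\<^sub>v v)"
    using Z by (auto simp: psd_mats_def sym_mats_def)
  have "?D\<^sup>T = ?D"
    using transpose_four_block_mat[of "1\<^sub>m c" c c "0\<^sub>m c k" k "0\<^sub>m k c" k Z] Zc ZT by simp
  moreover have "0 \<le> x \<bullet> (?D *\<^sub>v x)" if x: "x \<in> carrier_vec (c + k)" for x
  proof -
    have "x = vec_first x c @\<^sub>v vec_last x k" using vec_first_last_append[OF x] by simp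
    moreover have "0 \<le> vec_first x c \<bullet> vec_first x c" by (simp add: scalar_prod_def sum_nonneg)
    ultimately show ?thesis
      using block_diag_one_quadratic[OF Zc, of "vec_first x c" c "vec_last x k"] nonneg[of "vec_last x k"]
      by auto
  qed
  ultimately show ?thesis using Zc by (auto simp: psd_mats_def sym_mats_def)
qed

lemma one_mat_psd: "1\<^sub>m n \<in> psd_mats n"
proof -
  have "0 \<le> v \<bullet> v" for v :: "real vec" by (simp add: scalar_prod_def sum_nonneg)
  then show ?thesis by (simp add: psd_mats_def sym_mats_def)
qed

section \<open>Limits of matrices\<close>

definition mat_tendsto :: "nat \<Rightarrow> nat \<Rightarrow> (nat \<Rightarrow> real mat) \<Rightarrow> real mat \<Rightarrow> bool" where
  "mat_tendsto n m F A \<longleftrightarrow> (\<forall>k. F k \<in> carrier_mat n m) \<and> A \<in> carrier_mat n m \<and>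
     (\<forall>i<n. \<forall>j<m. (\<lambda>k. F k $$ (i, j)) \<longlonglongrightarrow> A $$ (i, j))"

lemma mat_tendsto_const: "A \<in> carrier_mat n m \<Longrightarrow> mat_tendsto n m (\<lambda>_. A) A"
  by (simp add: mat_tendsto_def)

lemma mat_tendsto_transpose:
  "mat_tendsto n m F A \<Longrightarrow> mat_tendsto m n (\<lambda>k. (F k)\<^sup>T) A\<^sup>T"
  unfolding mat_tendsto_def
proof (intro conjI allI impI, goal_cases)
  case (3 i j)
  then have "(F k)\<^sup>T $$ (i, j) = F k $$ (j, i)" for k
    by (intro index_transpose_mat) auto
  with 3 show ?case by auto
qed auto

lemma mat_tendsto_mult:
  assumes "mat_tendsto n m F A" "mat_tendsto m p H B"
  shows "mat_tendsto n p (\<lambda>k. F k * H k) (A * B)"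
proof -
  have FH: "F k \<in> carrier_mat n m" "H k \<in> carrier_mat m p" for k
    using assms by (auto simp: mat_tendsto_def)
  have AB: "A \<in> carrier_mat n m" "B \<in> carrier_mat m p"
    using assms by (auto simp: mat_tendsto_def)
  have "(\<lambda>k. (F k * H k) $$ (i, j)) \<longlonglongrightarrow> (A * B) $$ (i, j)" if ij: "i < n" "j < p" for i j
  proof -
    have entry: "(P * Q) $$ (i, j) = (\<Sum>l = 0..<m. P $$ (i, l) * Q $$ (l, j))"
      if "P \<in> carrier_mat n m" "Q \<in> carrier_mat m p" for P Q :: "real mat"
      using that ij by (simp add: scalar_prod_def)
    have "(\<lambda>k. \<Sum>l = 0..<m. F k $$ (i, l) * H k $$ (l, j)) \<longlonglongrightarrow> (\<Sum>l = 0..<m. A $$ (i, l) * B $$ (l, j))"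
      using assms ij by (intro tendsto_sum tendsto_mult) (auto simp: mat_tendsto_def)
    then show ?thesis by (simp add: entry[OF FH] entry[OF AB])
  qed
  then show ?thesis
    using mult_carrier_mat[OF FH] mult_carrier_mat[OF AB] by (auto simp: mat_tendsto_def)
qed

lemma mat_tendsto_unique:
  assumes "mat_tendsto n m F A" "mat_tendsto n m F B"
  shows "A = B"
proof (rule eq_matI)
  fix i j assume "i < dim_row B" "j < dim_col B"
  then show "A $$ (i, j) = B $$ (i, j)"
    using assms LIMSEQ_unique[of "\<lambda>k. F k $$ (i, j)"] by (auto simp: mat_tendsto_def)
qed (use assms in \<open>auto simp: mat_tendsto_def\<close>)

lemma mat_tendsto_det:
  assumes "mat_tendsto n n F A"
  shows "(\<lambda>k. det (F k)) \<longlonglongrightarrow> det A"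
proof -
  have "(\<lambda>k. \<Sum>p | p permutes {0..<n}. signof p * (\<Prod>i = 0..<n. F k $$ (i, p i)))
    \<longlonglongrightarrow> (\<Sum>p | p permutes {0..<n}. signof p * (\<Prod>i = 0..<n. A $$ (i, p i)))"
    using assms permutes_in_image[where S = "{0..<n}"]
    by (intro tendsto_sum tendsto_mult tendsto_prod tendsto_const) (fastforce simp: mat_tendsto_def)
  moreover have "det (F k) = (\<Sum>p | p permutes {0..<n}. signof p * (\<Prod>i = 0..<n. F k $$ (i, p i)))" for k
    using assms by (auto simp: mat_tendsto_def intro!: det_def')
  moreover have "det A = (\<Sum>p | p permutes {0..<n}. signof p * (\<Prod>i = 0..<n. A $$ (i, p i)))"
    using assms by (auto simp: mat_tendsto_def intro!: det_def')
  ultimately show ?thesis by simp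
qed

text \<open>\<open>C\<close> and its Gram matrix have the same kernel, since x^T C^T C x is the
  squared norm of C x. Full column rank thus becomes the nonvanishing of a continuous function of
  the entries.\<close>

lemma det_gram_nonzero_iff:
  fixes C :: "real mat"
  assumes C: "C \<in> carrier_mat n r"
  shows "det (C\<^sup>T * C) \<noteq> 0 \<longleftrightarrow> (\<forall>x\<in>carrier_vec r. C *\<^sub>v x = 0\<^sub>v n \<longrightarrow> x = 0\<^sub>v r)"
proof -
  have CC: "C\<^sup>T * C \<in> carrier_mat r r" using C by simp
  have "(C\<^sup>T * C) *\<^sub>v x = 0\<^sub>v r \<longleftrightarrow> C *\<^sub>v x = 0\<^sub>v n" if x: "x \<in> carrier_vec r" for x
  proof
    have Cx: "C *\<^sub>v x \<in> carrier_vec n" using C x by (rule mult_mat_vec_carrier)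
    have CTC: "(C\<^sup>T * C) *\<^sub>v x = C\<^sup>T *\<^sub>v (C *\<^sub>v x)" using C x by (intro assoc_mult_mat_vec) auto
    {
      assume "(C\<^sup>T * C) *\<^sub>v x = 0\<^sub>v r"
      then have "(C *\<^sub>v x) \<bullet> (C *\<^sub>v x) = 0"
        using transpose_vec_mult_scalar[OF C x Cx] CTC x by simp
      then show "C *\<^sub>v x = 0\<^sub>v n"
        using conjugate_square_eq_0_vec[OF Cx] by (simp add: conjugate_real_vec)
    }
    show "C *\<^sub>v x = 0\<^sub>v n \<Longrightarrow> (C\<^sup>T * C) *\<^sub>v x = 0\<^sub>v r"
      using CTC C by (intro eq_vecI) auto
  qed
  then show ?thesis
    using det_0_iff_vec_prod_zero[OF CC] by blast
qed

text \<open>A witness \<open>B\<close> for the rank of the limit is kept fixed: the Gram determinant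
  of \<open>A * B\<close> is nonzero, hence so are those of \<open>F k * B\<close> for large
  \<open>k\<close>.\<close>

lemma mat_rank_lower_semicontinuous:
  assumes lim: "mat_tendsto n m F A" and r: "r \<le> mat_rank A"
  shows "\<forall>\<^sub>F k in sequentially. r \<le> mat_rank (F k)"
proof -
  have F: "F k \<in> carrier_mat n m" for k using lim by (auto simp: mat_tendsto_def)
  have A: "A \<in> carrier_mat n m" using lim by (auto simp: mat_tendsto_def)
  obtain B where B: "B \<in> carrier_mat m r"
    and ker: "\<forall>x\<in>carrier_vec r. A *\<^sub>v (B *\<^sub>v x) = 0\<^sub>v n \<longrightarrow> x = 0\<^sub>v r"
    using r mat_rank_ge_iff[OF A] by blast
  have iff: "det ((P * B)\<^sup>T * (P * B)) \<noteq> 0 \<longleftrightarrow>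
      (\<forall>x\<in>carrier_vec r. P *\<^sub>v (B *\<^sub>v x) = 0\<^sub>v n \<longrightarrow> x = 0\<^sub>v r)" if P: "P \<in> carrier_mat n m" for P
    using det_gram_nonzero_iff[OF mult_carrier_mat[OF P B]] assoc_mult_mat_vec[OF P B] by simp
  have "(\<lambda>k. det ((F k * B)\<^sup>T * (F k * B))) \<longlonglongrightarrow> det ((A * B)\<^sup>T * (A * B))"
    by (rule mat_tendsto_det, rule mat_tendsto_mult, rule mat_tendsto_transpose)
      (rule mat_tendsto_mult[OF lim mat_tendsto_const[OF B]])+
  moreover have "det ((A * B)\<^sup>T * (A * B)) \<noteq> 0" using iff[OF A] ker by blast
  ultimately have "\<forall>\<^sub>F k in sequentially. det ((F k * B)\<^sup>T * (F k * B)) \<noteq> 0"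
    by (rule tendsto_imp_eventually_ne)
  then show ?thesis
    by eventually_elim (use iff[OF F] mat_rank_ge_iff[OF F] B in blast)
qed

text \<open>Bolzano-Weierstrass in finitely many coordinates: the induction thins out the
  subsequence once per coordinate, to one that is monotone and bounded there.\<close>

lemma convergent_subsequence_finite:
  fixes f :: "nat \<Rightarrow> 'i \<Rightarrow> real"
  assumes "finite I" and "\<And>k i. i \<in> I \<Longrightarrow> \<bar>f k i\<bar> \<le> c"
  shows "\<exists>\<sigma> g. strict_mono (\<sigma> :: nat \<Rightarrow> nat) \<and> (\<forall>i\<in>I. (\<lambda>k. f (\<sigma> k) i) \<longlonglongrightarrow> g i)"
  using assms
proof (induction I rule: finite_induct)
  case empty
  show ?case by (rule exI[of _ id]) (simp add: strict_mono_def)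
next
  case (insert a I)
  have "\<exists>\<sigma> g. strict_mono (\<sigma> :: nat \<Rightarrow> nat) \<and> (\<forall>i\<in>I. (\<lambda>k. f (\<sigma> k) i) \<longlonglongrightarrow> g i)"
    using insert.prems by (intro insert.IH) auto
  then obtain \<sigma> :: "nat \<Rightarrow> nat" and g where \<sigma>: "strict_mono \<sigma>"
    and g: "\<And>i. i \<in> I \<Longrightarrow> (\<lambda>k. f (\<sigma> k) i) \<longlonglongrightarrow> g i" by blast
  obtain \<tau> :: "nat \<Rightarrow> nat" where \<tau>: "strict_mono \<tau>" "monoseq (\<lambda>k. f (\<sigma> (\<tau> k)) a)"
    using seq_monosub[of "\<lambda>k. f (\<sigma> k) a"] by blast
  have "Bseq (\<lambda>k. f (\<sigma> (\<tau> k)) a)"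
    using insert.prems by (intro BseqI'[of _ c]) auto
  then obtain L where L: "(\<lambda>k. f (\<sigma> (\<tau> k)) a) \<longlonglongrightarrow> L"
    using Bseq_monoseq_convergent[OF _ \<tau>(2)] by (auto simp: convergent_def)
  have "(\<lambda>k. f (\<sigma> (\<tau> k)) i) \<longlonglongrightarrow> g i" if "i \<in> I" for i
    using LIMSEQ_subseq_LIMSEQ[OF g[OF that] \<tau>(1)] by (simp add: o_def)
  with L have "\<forall>i\<in>insert a I. (\<lambda>k. f ((\<sigma> \<circ> \<tau>) k) i) \<longlonglongrightarrow> (g(a := L)) i"
    using insert.hyps(2) by auto
  then show ?case using strict_mono_o[OF \<sigma> \<tau>(1)] by blast
qed

lemma mat_bounded_subsequence:
  assumes F: "\<And>k. F k \<in> carrier_mat n m"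
    and bound: "\<And>k i j. i < n \<Longrightarrow> j < m \<Longrightarrow> \<bar>F k $$ (i, j)\<bar> \<le> c"
  obtains \<sigma> A where "strict_mono (\<sigma> :: nat \<Rightarrow> nat)" "mat_tendsto n m (\<lambda>k. F (\<sigma> k)) A"
proof -
  obtain \<sigma> g where \<sigma>: "strict_mono (\<sigma> :: nat \<Rightarrow> nat)"
    and g: "\<forall>p\<in>{..<n} \<times> {..<m}. (\<lambda>k. F (\<sigma> k) $$ p) \<longlonglongrightarrow> g p"
    using convergent_subsequence_finite[of "{..<n} \<times> {..<m}" "\<lambda>k p. F k $$ p" c] bound by auto
  have "mat_tendsto n m (\<lambda>k. F (\<sigma> k)) (mat n m g)"
    using F g by (auto simp: mat_tendsto_def)
  with \<sigma> show thesis by (rule that)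
qed

lemma psd_mats_closed:
  assumes lim: "mat_tendsto n n F A" and psd: "\<And>k. F k \<in> psd_mats n"
  shows "A \<in> psd_mats n"
proof -
  have A: "A \<in> carrier_mat n n" using lim by (auto simp: mat_tendsto_def)
  have FT: "(F k)\<^sup>T = F k" for k using psd by (auto simp: psd_mats_def sym_mats_def)
  have "A\<^sup>T = A"
    using mat_tendsto_unique[OF mat_tendsto_transpose[OF lim]] lim by (simp add: FT)
  moreover have "0 \<le> v \<bullet> (A *\<^sub>v v)" if v: "v \<in> carrier_vec n" for v
  proof -
    have form: "v \<bullet> (P *\<^sub>v v) = (\<Sum>i = 0..<n. v $ i * (\<Sum>j = 0..<n. P $$ (i, j) * v $ j))"
      if "P \<in> carrier_mat n n" for P :: "real mat"
      using that v by (simp add: scalar_prod_def)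
    have "(\<lambda>k. \<Sum>i = 0..<n. v $ i * (\<Sum>j = 0..<n. F k $$ (i, j) * v $ j))
      \<longlonglongrightarrow> (\<Sum>i = 0..<n. v $ i * (\<Sum>j = 0..<n. A $$ (i, j) * v $ j))"
      using lim by (intro tendsto_sum tendsto_mult tendsto_const) (auto simp: mat_tendsto_def)
    moreover have "0 \<le> (\<Sum>i = 0..<n. v $ i * (\<Sum>j = 0..<n. F k $$ (i, j) * v $ j))" for k
      using psd[of k] v form[of "F k"] by (auto simp: psd_mats_def sym_mats_def)
    ultimately have "0 \<le> (\<Sum>i = 0..<n. v $ i * (\<Sum>j = 0..<n. A $$ (i, j) * v $ j))"
      by (intro LIMSEQ_le_const) auto
    then show ?thesis using form[OF A] by simp
  qed
  ultimately show ?thesis using A by (auto simp: psd_mats_def sym_mats_def)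
qed

text \<open>A singular shift makes \<open>- e k\<close> an eigenvalue of \<open>W\<close>, hence a
  root of the characteristic polynomial; as \<open>e\<close> is injective, this happens for finitely
  many \<open>k\<close> only.\<close>

lemma eventually_det_shift_nonzero:
  fixes W :: "real mat" and e :: "nat \<Rightarrow> real"
  assumes W: "W \<in> carrier_mat l l" and e: "inj e"
  shows "\<forall>\<^sub>F k in sequentially. det (W + e k \<cdot>\<^sub>m 1\<^sub>m l) \<noteq> 0"
proof -
  have "char_poly W \<noteq> 0"
    using degree_monic_char_poly[OF W] by auto
  then have fin: "finite ((\<lambda>k. - e k) -` {x. poly (char_poly W) x = 0})"
    using poly_roots_finite e by (intro finite_vimageI) (auto simp: inj_def)
  have "poly (char_poly W) (- e k) = 0" if det: "det (W + e k \<cdot>\<^sub>m 1\<^sub>m l) = 0" for k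
  proof -
    obtain v where v: "v \<in> carrier_vec l" "v \<noteq> 0\<^sub>v l" "(W + e k \<cdot>\<^sub>m 1\<^sub>m l) *\<^sub>v v = 0\<^sub>v l"
      using det det_0_iff_vec_prod_zero[of "W + e k \<cdot>\<^sub>m 1\<^sub>m l" l] W by auto
    have "W *\<^sub>v v = (- e k) \<cdot>\<^sub>v v"
    proof (rule eq_vecI)
      fix i assume "i < dim_vec ((- e k) \<cdot>\<^sub>v v)"
      then have i: "i < l" using v by simp
      have "(\<Sum>j = 0..<l. e k * (if j = i then 1 else 0) * v $ j) =
        (\<Sum>j = 0..<l. if j = i then e k * v $ j else 0)"
        by (rule sum.cong) auto
      then have "((W + e k \<cdot>\<^sub>m 1\<^sub>m l) *\<^sub>v v) $ i = (\<Sum>j = 0..<l. W $$ (i, j) * v $ j) + e k * v $ i"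
        using i W v(1) by (simp add: scalar_prod_def distrib_right sum.distrib)
      then have "(\<Sum>j = 0..<l. W $$ (i, j) * v $ j) + e k * v $ i = 0"
        using i v(3) by simp
      moreover have "(W *\<^sub>v v) $ i = (\<Sum>j = 0..<l. W $$ (i, j) * v $ j)"
        using i W v(1) by (simp add: scalar_prod_def)
      ultimately show "(W *\<^sub>v v) $ i = ((- e k) \<cdot>\<^sub>v v) $ i"
        using i v(1) by simp
    qed (use v W in auto)
    then have "eigenvalue W (- e k)"
      using v W by (auto simp: eigenvalue_def eigenvector_def)
    then show ?thesis using eigenvalue_root_char_poly[OF W] by simp
  qed
  then have "finite {k. det (W + e k \<cdot>\<^sub>m 1\<^sub>m l) = 0}"
    by (intro finite_subset[OF _ fin]) auto
  then show ?thesis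
    by (simp add: eventually_cofinite flip: cofinite_eq_sequentially)
qed

section \<open>Extremal data for phi\<close>

lemma phi_set_subset_carrier: "Y \<in> phi_set l U M \<Longrightarrow> Y \<in> carrier_mat (2 * l) (2 * l)"
  by (simp add: phi_set_def psd_mats_def sym_mats_def)

lemma phi_set_blocks:
  assumes "Y \<in> phi_set l U M" "i < l" "j < l"
  shows "Y $$ (i, j) = (if i = j then 1 else 0)" "Y $$ (l + i, l + j) = (if i = j then 1 else 0)"
proof -
  have "mat l l (\<lambda>(i, j). Y $$ (i, j)) $$ (i, j) = 1\<^sub>m l $$ (i, j)"
    "mat l l (\<lambda>(i, j). Y $$ (l + i, l + j)) $$ (i, j) = 1\<^sub>m l $$ (i, j)"
    using assms(1) by (simp_all only: phi_set_def mem_Collect_eq)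
  then show "Y $$ (i, j) = (if i = j then 1 else 0)" "Y $$ (l + i, l + j) = (if i = j then 1 else 0)"
    using assms(2,3) by auto
qed

lemma phi_setI:
  assumes "Y \<in> psd_mats (2 * l)" "U\<^sup>T * Y * U = M"
    and "\<And>i j. i < l \<Longrightarrow> j < l \<Longrightarrow> Y $$ (i, j) = (if i = j then 1 else 0)"
    and "\<And>i j. i < l \<Longrightarrow> j < l \<Longrightarrow> Y $$ (l + i, l + j) = (if i = j then 1 else 0)"
  shows "Y \<in> phi_set l U M"
  using assms unfolding phi_set_def by (auto intro!: eq_matI)

text \<open>By minimality, the bound defining \<open>phi l\<close> fails for the preceding integer,
  and any counterexample to it is extremal data.\<close>

lemma phi_attained:
  assumes "l > 0"
  obtains U M where "U \<in> carrier_mat (2 * l) l" "M \<in> sym_mats l" "phi_set l U M \<noteq> {}"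
    "\<And>Y. Y \<in> phi_set l U M \<Longrightarrow> phi l \<le> mat_rank Y"
proof -
  define P where "P r \<longleftrightarrow> (\<forall>U\<in>carrier_mat (2 * l) l. \<forall>M\<in>sym_mats l.
    phi_set l U M = {} \<or> (\<exists>Y\<in>phi_set l U M. mat_rank Y \<le> r))" for r
  have phi: "phi l = (LEAST r. P r)" using assms by (simp add: phi_def P_def)
  show thesis
  proof (cases "phi l")
    case 0
    \<comment> \<open>The value \<open>0\<close> has no preceding integer, but then any data with a
      feasible matrix will do; here the zero constraint, which the identity satisfies.\<close>
    let ?U = "0\<^sub>m (2 * l) l :: real mat"
    have "1\<^sub>m (2 * l) \<in> phi_set l ?U (0\<^sub>m l l)"
      by (intro phi_setI one_mat_psd) (auto intro!: eq_matI simp: scalar_prod_def)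
    with 0 show ?thesis by (intro that[of ?U "0\<^sub>m l l"]) (auto simp: sym_mats_def)
  next
    case (Suc r)
    then have "\<not> P r" using not_less_Least[of r P] phi by simp
    then obtain U M where "U \<in> carrier_mat (2 * l) l" "M \<in> sym_mats l" "phi_set l U M \<noteq> {}"
      "\<forall>Y\<in>phi_set l U M. \<not> mat_rank Y \<le> r" by (auto simp: P_def)
    with Suc show ?thesis by (intro that[of U M]) (auto simp: not_le Suc_le_eq)
  qed
qed

text \<open>The minimal rank over \<open>phi_set l U M\<close> is lower semicontinuous along feasible data, so the
  extremal \<open>U\<close> may be perturbed, keeping one feasible \<open>Y\<close>.\<close>

lemma phi_set_invertible_blocks:
  assumes U: "U \<in> carrier_mat (2 * l) l" and Y0: "Y0 \<in> phi_set l U M"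
    and rank: "\<And>Y. Y \<in> phi_set l U M \<Longrightarrow> r \<le> mat_rank Y"
  obtains U' Y' where "U' \<in> carrier_mat (2 * l) l" "Y' \<in> phi_set l U' (U'\<^sup>T * Y' * U')"
    "\<And>Y. Y \<in> phi_set l U' (U'\<^sup>T * Y' * U') \<Longrightarrow> r \<le> mat_rank Y"
    "det (mat l l (\<lambda>(i, j). U' $$ (i, j))) \<noteq> 0" "det (mat l l (\<lambda>(i, j). U' $$ (l + i, j))) \<noteq> 0"
proof -
  define e where "e k = 1 / real (Suc k)" for k
  have e: "inj e" "e \<longlonglongrightarrow> 0"
    using LIMSEQ_inverse_real_of_nat by (auto simp: e_def[abs_def] inj_def inverse_eq_divide)
  \<comment> \<open>A multiple of the identity is added to both square blocks of \<open>U\<close>;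
    all but finitely many of the \<open>e k\<close> make both blocks invertible.\<close>
  define Uk where "Uk k = mat (2 * l) l (\<lambda>(i, j). U $$ (i, j) + (if i = j \<or> i = l + j then e k else 0))" for k
  have Uk: "Uk k \<in> carrier_mat (2 * l) l" for k by (simp add: Uk_def)
  \<comment> \<open>The right-hand side moves along, so that \<open>Y0\<close> stays
    feasible.\<close>
  define Mk where "Mk k = (Uk k)\<^sup>T * Y0 * Uk k" for k
  have blocks: "mat l l (\<lambda>(i, j). Uk k $$ (i, j)) = mat l l (\<lambda>(i, j). U $$ (i, j)) + e k \<cdot>\<^sub>m 1\<^sub>m l"
    "mat l l (\<lambda>(i, j). Uk k $$ (l + i, j)) = mat l l (\<lambda>(i, j). U $$ (l + i, j)) + e k \<cdot>\<^sub>m 1\<^sub>m l" for k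
    by (auto simp: Uk_def intro!: eq_matI)
  have "\<forall>\<^sub>F k in sequentially. det (mat l l (\<lambda>(i, j). Uk k $$ (i, j))) \<noteq> 0 \<and>
      det (mat l l (\<lambda>(i, j). Uk k $$ (l + i, j))) \<noteq> 0"
    unfolding blocks by (intro eventually_conj eventually_det_shift_nonzero e(1)) auto
  then obtain k0 where k0: "\<And>k. k \<ge> k0 \<Longrightarrow> det (mat l l (\<lambda>(i, j). Uk k $$ (i, j))) \<noteq> 0 \<and>
      det (mat l l (\<lambda>(i, j). Uk k $$ (l + i, j))) \<noteq> 0"
    by (auto simp: eventually_sequentially)
  have Y0k: "Y0 \<in> phi_set l (Uk k) (Mk k)" for k
    using Y0 by (simp add: phi_set_def Mk_def)
  have "\<exists>k\<ge>k0. \<forall>Y\<in>phi_set l (Uk k) (Mk k). r \<le> mat_rank Y"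
  proof (rule ccontr)
    assume "\<not> ?thesis"
    then have "\<forall>k. \<exists>Y\<in>phi_set l (Uk (k0 + k)) (Mk (k0 + k)). mat_rank Y < r"
      by (auto simp: not_le)
    then obtain Z where Z: "\<And>k. Z k \<in> phi_set l (Uk (k0 + k)) (Mk (k0 + k))"
      and Zr: "\<And>k. mat_rank (Z k) < r" by metis
    have Zpsd: "Z k \<in> psd_mats (2 * l)" for k using Z[of k] by (simp add: phi_set_def)
    \<comment> \<open>The unit diagonal bounds all entries of \<open>Z k\<close>, so a subsequence
      converges. Its limit is feasible for \<open>U\<close> and \<open>M\<close> and has rank at
      least \<open>r\<close>, whereas every \<open>Z k\<close> has smaller rank, against
      semicontinuity.\<close>
    have diag: "Z k $$ (i, i) = 1" if "i < 2 * l" for i k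
      using phi_set_blocks(1)[OF Z, of i i k] phi_set_blocks(2)[OF Z, of "i - l" "i - l" k] that
      by (cases "i < l") auto
    have "\<bar>Z k $$ (i, j)\<bar> \<le> 1" if "i < 2 * l" "j < 2 * l" for i j k
      using psd_entry_bound[OF Zpsd that] diag that by simp
    with phi_set_subset_carrier[OF Z] obtain \<sigma> Y where \<sigma>: "strict_mono (\<sigma> :: nat \<Rightarrow> nat)"
      and lim: "mat_tendsto (2 * l) (2 * l) (\<lambda>k. Z (\<sigma> k)) Y"
      by (rule mat_bounded_subsequence)
    have limU: "mat_tendsto (2 * l) l (\<lambda>k. Uk (k0 + \<sigma> k)) U"
    proof -
      have "strict_mono (\<lambda>k. k0 + \<sigma> k)" using \<sigma> by (simp add: strict_mono_def)
      from LIMSEQ_subseq_LIMSEQ[OF e(2) this] have "(\<lambda>k. e (k0 + \<sigma> k)) \<longlonglongrightarrow> 0" by (simp add: o_def)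
      then have "(\<lambda>k. U $$ (i, j) + (if i = j \<or> i = l + j then e (k0 + \<sigma> k) else 0)) \<longlonglongrightarrow> U $$ (i, j) + 0" for i j
        by (intro tendsto_add tendsto_const) (cases "i = j \<or> i = l + j"; simp)
      then show ?thesis using U by (auto simp: mat_tendsto_def Uk_def)
    qed
    have form: "mat_tendsto l l (\<lambda>k. (Uk (k0 + \<sigma> k))\<^sup>T * H k * Uk (k0 + \<sigma> k)) (U\<^sup>T * A * U)"
      if "mat_tendsto (2 * l) (2 * l) H A" for H A
      using mat_tendsto_mult[OF mat_tendsto_mult[OF mat_tendsto_transpose[OF limU] that] limU] .
    have "U\<^sup>T * Y * U = U\<^sup>T * Y0 * U"
    proof (rule mat_tendsto_unique)
      \<comment> \<open>The matrices \<open>Mk\<close> converge to both forms: along the feasible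
        \<open>Z\<close>, and with \<open>Y0\<close> fixed.\<close>
      show "mat_tendsto l l (\<lambda>k. Mk (k0 + \<sigma> k)) (U\<^sup>T * Y * U)"
        using form[OF lim] Z by (simp add: phi_set_def)
      show "mat_tendsto l l (\<lambda>k. Mk (k0 + \<sigma> k)) (U\<^sup>T * Y0 * U)"
        using form[OF mat_tendsto_const[OF phi_set_subset_carrier[OF Y0]]] by (simp add: Mk_def)
    qed
    also have "\<dots> = M" using Y0 by (simp add: phi_set_def)
    finally have "U\<^sup>T * Y * U = M" .
    moreover have "Y \<in> psd_mats (2 * l)"
      using psd_mats_closed[OF lim] Zpsd by blast
    moreover have "Y $$ (i, j) = (if i = j then 1 else 0)" if "i < l" "j < l" for i j
    proof -
      have "(\<lambda>k. Z (\<sigma> k) $$ (i, j)) \<longlonglongrightarrow> Y $$ (i, j)"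
        using lim that by (auto simp: mat_tendsto_def)
      then show ?thesis by (simp add: phi_set_blocks(1)[OF Z that] LIMSEQ_const_iff)
    qed
    moreover have "Y $$ (l + i, l + j) = (if i = j then 1 else 0)" if "i < l" "j < l" for i j
    proof -
      have "(\<lambda>k. Z (\<sigma> k) $$ (l + i, l + j)) \<longlonglongrightarrow> Y $$ (l + i, l + j)"
        using lim that by (auto simp: mat_tendsto_def)
      then show ?thesis by (simp add: phi_set_blocks(2)[OF Z that] LIMSEQ_const_iff)
    qed
    ultimately have "Y \<in> phi_set l U M" by (intro phi_setI)
    then have "\<forall>\<^sub>F k in sequentially. r \<le> mat_rank (Z (\<sigma> k))"
      using rank mat_rank_lower_semicontinuous[OF lim] by blast
    then show False
      using Zr by (auto simp: eventually_sequentially not_le[symmetric])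
  qed
  then obtain k where "k \<ge> k0" "\<forall>Y\<in>phi_set l (Uk k) (Mk k). r \<le> mat_rank Y" by blast
  with that[of "Uk k" Y0] Uk Y0k[of k] k0 show thesis by (simp add: Mk_def)
qed

section \<open>Semidefinite programs given by equations\<close>

lemma trace_inner_sum:
  assumes "A \<in> carrier_mat n n" "X \<in> carrier_mat n n"
  shows "trace_inner A X = (\<Sum>i = 0..<n. \<Sum>j = 0..<n. A $$ (j, i) * X $$ (j, i))"
  using assms unfolding trace_inner_def
  by (auto simp: scalar_prod_def atLeast0LessThan intro!: sum.cong)

text \<open>On a positive semidefinite \<open>X\<close> every summand is nonnegative, so a single
  equation with right-hand side \<open>0\<close> puts all \<open>l\<close> columns of
  \<open>F\<close> into the kernel of \<open>X\<close>.\<close>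

lemma trace_inner_gram:
  assumes F: "F \<in> carrier_mat n l" and X: "X \<in> carrier_mat n n"
  shows "trace_inner (F * F\<^sup>T) X = (\<Sum>a = 0..<l. col F a \<bullet> (X *\<^sub>v col F a))"
proof -
  have FF: "F * F\<^sup>T \<in> carrier_mat n n" using F by simp
  have "trace_inner (F * F\<^sup>T) X = (\<Sum>i = 0..<n. \<Sum>j = 0..<n. \<Sum>a = 0..<l. F $$ (j, a) * F $$ (i, a) * X $$ (j, i))"
    unfolding trace_inner_sum[OF FF X]
    using F by (intro sum.cong refl) (auto simp: scalar_prod_def sum_distrib_right)
  also have "\<dots> = (\<Sum>i = 0..<n. \<Sum>a = 0..<l. \<Sum>j = 0..<n. F $$ (j, a) * F $$ (i, a) * X $$ (j, i))"
    by (intro sum.cong refl sum.swap)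
  also have "\<dots> = (\<Sum>a = 0..<l. \<Sum>i = 0..<n. \<Sum>j = 0..<n. F $$ (j, a) * F $$ (i, a) * X $$ (j, i))"
    by (rule sum.swap)
  also have "\<dots> = (\<Sum>a = 0..<l. \<Sum>j = 0..<n. \<Sum>i = 0..<n. F $$ (j, a) * F $$ (i, a) * X $$ (j, i))"
    by (intro sum.cong refl sum.swap)
  also have "\<dots> = (\<Sum>a = 0..<l. col F a \<bullet> (X *\<^sub>v col F a))"
    using F X by (intro sum.cong refl) (auto simp: scalar_prod_def sum_distrib_left ac_simps intro!: sum.cong)
  finally show ?thesis .
qed

text \<open>On the diagonal the two summands coincide and give the entry \<open>2\<close>, so that
  pairing with a symmetric \<open>X\<close> yields twice the entry in all cases.\<close>

definition elem_sym :: "nat \<Rightarrow> nat \<Rightarrow> nat \<Rightarrow> real mat" where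
  "elem_sym n i j = mat n n (\<lambda>(a, b). (if a = i \<and> b = j then 1 else 0) + (if a = j \<and> b = i then 1 else 0))"

lemma elem_sym_in_sym_mats: "elem_sym n i j \<in> sym_mats n"
proof -
  have "(elem_sym n i j)\<^sup>T = elem_sym n i j"
    by (rule eq_matI) (simp_all add: elem_sym_def conj_commute)
  then show ?thesis by (simp add: sym_mats_def elem_sym_def)
qed

lemma trace_inner_elem_sym:
  assumes X: "X \<in> sym_mats n" and ij: "i < n" "j < n"
  shows "trace_inner (elem_sym n i j) X = 2 * X $$ (i, j)"
proof -
  have Xc: "X \<in> carrier_mat n n" using X by (simp add: sym_mats_def)
  have Ec: "elem_sym n i j \<in> carrier_mat n n" by (simp add: elem_sym_def)
  have "trace_inner (elem_sym n i j) X = (\<Sum>b = 0..<n. \<Sum>a = 0..<n.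
      (if a = i then if b = j then X $$ (a, b) else 0 else 0) + (if a = j then if b = i then X $$ (a, b) else 0 else 0))"
    unfolding trace_inner_sum[OF Ec Xc]
    by (intro sum.cong refl) (simp add: elem_sym_def distrib_right)
  also have "\<dots> = X $$ (i, j) + X $$ (j, i)"
    using ij by (simp add: sum.distrib)
  finally show ?thesis using sym_matsD[OF X ij] by simp
qed

text \<open>With objective \<open>0\<close> every feasible point is optimal.\<close>

lemma sdp_of_equations:
  assumes "finite C" and F: "F \<in> carrier_mat n l"
    and C: "\<And>A b. (A, b) \<in> C \<Longrightarrow> A \<in> sym_mats n \<and>
      (\<exists>S\<in>sparse_sym_mats n G. \<exists>K\<in>carrier_mat l n. A = S + F * K)"
  obtains P where "sdp_problem n P" "splr n G l P"
    "sdp_optimal n P = {X \<in> psd_mats n. \<forall>(A, b)\<in>C. trace_inner A X = b}"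
proof -
  obtain cs where cs: "set cs = C" using finite_list[OF \<open>finite C\<close>] by blast
  \<comment> \<open>Constraints are numbered from \<open>1\<close> and the list from
    \<open>0\<close>, hence \<open>i - 1\<close>; number \<open>0\<close> is the zero objective.
    Equal lower and upper bounds give equations.\<close>
  define P where "P = \<lparr> sdp_num = length cs,
    sdp_coeff = (\<lambda>i. if i = 0 then 0\<^sub>m n n else fst (cs ! (i - 1))),
    sdp_lower = (\<lambda>i. ereal (snd (cs ! (i - 1)))), sdp_upper = (\<lambda>i. ereal (snd (cs ! (i - 1)))) \<rparr>"
  have mem: "(sdp_coeff P i, snd (cs ! (i - 1))) \<in> C" if "i \<in> {1..sdp_num P}" for i
    using that nth_mem[of "i - 1" cs] by (auto simp: P_def cs)
  have zero: "0\<^sub>m n n \<in> sparse_sym_mats n G" by (simp add: sparse_sym_mats_def sym_mats_def)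
  have coeff: "sdp_coeff P i \<in> sym_mats n \<and>
      (\<exists>S\<in>sparse_sym_mats n G. \<exists>K\<in>carrier_mat l n. sdp_coeff P i = S + F * K)" if "i \<le> sdp_num P" for i
  proof (cases "i = 0")
    case True
    have "0\<^sub>m n n = 0\<^sub>m n n + F * 0\<^sub>m l n" using F by simp
    moreover have "sdp_coeff P i = 0\<^sub>m n n" using True by (simp add: P_def)
    moreover have "0\<^sub>m n n \<in> sym_mats n" using zero by (simp add: sparse_sym_mats_def)
    moreover have "0\<^sub>m l n \<in> carrier_mat l n" by simp
    ultimately show ?thesis using zero by metis
  next
    case False
    with that have "i \<in> {1..sdp_num P}" by simp
    from C[OF mem[OF this]] show ?thesis .
  qed
  have prob: "sdp_problem n P"
    using coeff by (auto simp: sdp_problem_def P_def)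
  have splr: "splr n G l P"
  proof -
    from coeff have "\<forall>i\<in>{..sdp_num P}. \<exists>S K. S \<in> sparse_sym_mats n G \<and> K \<in> carrier_mat l n \<and>
      sdp_coeff P i = S + F * K" by blast
    then obtain S K where SK: "\<And>i. i \<le> sdp_num P \<Longrightarrow> S i \<in> sparse_sym_mats n G \<and>
      K i \<in> carrier_mat l n \<and> sdp_coeff P i = S i + F * K i"
      by (metis atMost_iff)
    let ?cols = "concat (map (\<lambda>i. cols (F * K i)) [0..<Suc (sdp_num P)])"
    \<comment> \<open>All low-rank parts share the left factor \<open>F\<close>, so the
      concatenation has its columns in the range of \<open>F\<close>, of dimension at most
      \<open>l\<close>.\<close>
    have range: "\<exists>x\<in>carrier_vec l. v = F *\<^sub>v x" if v: "v \<in> set ?cols" for v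
    proof -
      obtain i where i: "i \<le> sdp_num P" "v \<in> set (cols (F * K i))"
        using v by (auto simp: less_Suc_eq_le simp del: upt_Suc)
      then have "K i \<in> carrier_mat l n" using SK by blast
      moreover from this obtain j where ij: "j < n" "v = col (F * K i) j"
        using i F by (auto simp: cols_def)
      ultimately have "v = F *\<^sub>v col (K i) j" "col (K i) j \<in> carrier_vec l"
        using ij col_mult2[OF F] by auto
      then show ?thesis by blast
    qed
    have "\<exists>x\<in>carrier_vec l. col (mat_of_cols n ?cols) j = F *\<^sub>v x" if j: "j < length ?cols" for j
    proof -
      obtain x where x: "x \<in> carrier_vec l" "?cols ! j = F *\<^sub>v x"
        using range[OF nth_mem[OF j]] by blast
      then have "?cols ! j \<in> carrier_vec n" using F by auto
      then have "col (mat_of_cols n ?cols) j = ?cols ! j" using j by (intro col_mat_of_cols)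
      with x show ?thesis by metis
    qed
    then have "mat_rank (mat_of_cols n ?cols) \<le> l"
      by (intro mat_rank_le_if_cols_in_range[OF _ F]) auto
    then show ?thesis
      unfolding splr_def using SK F by (intro exI[of _ S] exI[of _ "\<lambda>i. F * K i"]) auto
  qed
  have feas: "sdp_feasible n P = {X \<in> psd_mats n. \<forall>(A, b)\<in>C. trace_inner A X = b}"
  proof -
    have "(\<forall>i\<in>{1..sdp_num P}. sdp_lower P i \<le> ereal (trace_inner (sdp_coeff P i) X) \<and>
        ereal (trace_inner (sdp_coeff P i) X) \<le> sdp_upper P i) \<longleftrightarrow> (\<forall>(A, b)\<in>C. trace_inner A X = b)" for X
    proof
      assume L: "\<forall>i\<in>{1..sdp_num P}. sdp_lower P i \<le> ereal (trace_inner (sdp_coeff P i) X) \<and>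
        ereal (trace_inner (sdp_coeff P i) X) \<le> sdp_upper P i"
      have "trace_inner A X = b" if Ab: "(A, b) \<in> C" for A b
      proof -
        obtain k where "k < length cs" "cs ! k = (A, b)" using Ab cs by (metis in_set_conv_nth)
        with L[rule_format, of "Suc k"] show ?thesis by (simp add: P_def)
      qed
      then show "\<forall>(A, b)\<in>C. trace_inner A X = b" by blast
    next
      assume "\<forall>(A, b)\<in>C. trace_inner A X = b"
      then have "trace_inner (sdp_coeff P i) X = snd (cs ! (i - 1))" if "i \<in> {1..sdp_num P}" for i
        using mem[OF that] by fast
      then show "\<forall>i\<in>{1..sdp_num P}. sdp_lower P i \<le> ereal (trace_inner (sdp_coeff P i) X) \<and>
        ereal (trace_inner (sdp_coeff P i) X) \<le> sdp_upper P i" by (simp add: P_def)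
    qed
    then show ?thesis by (simp add: sdp_feasible_def)
  qed
  have "trace_inner (sdp_coeff P 0) X = 0" if "X \<in> psd_mats n" for X
    using that by (subst trace_inner_sum[of _ n]) (auto simp: P_def psd_mats_def sym_mats_def)
  then have "sdp_optimal n P = sdp_feasible n P"
    by (auto simp: sdp_optimal_def sdp_feasible_def)
  with prob splr feas that show thesis by simp
qed

lemma elem_sym_sparse:
  assumes "i = j \<or> (i, j) \<in> parcs G" and "graph_on n G"
  shows "elem_sym n i j \<in> sparse_sym_mats n G"
proof -
  interpret pair_graph G using assms(2) by (simp add: graph_on_def)
  have "elem_sym n i j $$ (a, b) = 0" if "a < n" "b < n" "a \<noteq> b" "(a, b) \<notin> parcs G" for a b
    using that assms(1) arcs_symmetric[of i j] by (auto simp: elem_sym_def)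
  then show ?thesis
    using elem_sym_in_sym_mats by (simp add: sparse_sym_mats_def)
qed

lemma elem_sym_sparse_plus_low_rank:
  assumes "i = j \<or> (i, j) \<in> parcs G" and "graph_on n G" and F: "F \<in> carrier_mat n l"
  shows "\<exists>S\<in>sparse_sym_mats n G. \<exists>K\<in>carrier_mat l n. elem_sym n i j = S + F * K"
proof -
  have "elem_sym n i j = elem_sym n i j + F * 0\<^sub>m l n"
    using F by (simp add: elem_sym_def)
  moreover have "0\<^sub>m l n \<in> carrier_mat l n" by simp
  ultimately show ?thesis using elem_sym_sparse[OF assms(1,2)] by blast
qed

text \<open>Every vertex is joined to the first \<open>w\<close> ones. A missing entry is recovered from
  $E_{ij} + E_{ji} = E_{ii} + E_{jj} - (e_i - e_j)(e_i - e_j)^T$, where $e_i - e_j$ runs through a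
  space of dimension \<open>l\<close>.\<close>

lemma sdp_rank_pathwidth:
  assumes "n \<ge> w + l + 1"
  shows "\<exists>P G. sdp_problem n P \<and> graph_on n G \<and> splr n G l P \<and>
    pathwidth G = w \<and> treewidth G = w \<and> sdp_optimal n P \<noteq> {} \<and>
    (\<forall>X\<in>sdp_optimal n P. mat_rank X \<ge> treewidth G + l + 1)"
proof -
  \<comment> \<open>One bag of size \<open>w + 1\<close> for each vertex outside the
    \<open>w\<close> universal ones, arranged along a path.\<close>
  define V where "V t = insert (w + t) {..<w}" for t
  define k where "k = n - w"
  define G where "G = bag_graph n k V"
  let ?N = "w + l + 1"
  have k: "k > 0" "n = w + k" using assms by (auto simp: k_def)
  have td: "tree_decomposition G (parent_tree k (\<lambda>i. i - 1)) V"
    unfolding G_def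
  proof (rule tree_decomposition_parent_tree[OF k(1)])
    show "{..<n} \<subseteq> (\<Union>t<k. V t)"
    proof
      fix x assume "x \<in> {..<n}"
      then have "x \<in> V (x - w)" "x - w < k" using k by (auto simp: V_def)
      then show "x \<in> (\<Union>t<k. V t)" by blast
    qed
  qed (use k in \<open>auto simp: V_def\<close>)
  have width: "treewidth G = w" "pathwidth G = w"
    using bag_graph_width[OF td[unfolded G_def] k(1), of w] path_graph_parent_tree[OF k(1)]
    by (auto simp: G_def V_def)
  have G: "graph_on n G" by (simp add: G_def graph_on_bag_graph)
  have edge: "(i, j) \<in> parcs G" if ij: "i < n" "j < n" "i \<noteq> j" "i < w \<or> j < w" for i j
  proof -
    \<comment> \<open>The bag of the larger vertex; for two universal vertices the truncated
      subtraction yields bag \<open>0\<close>.\<close>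
    have "\<exists>t<k. i \<in> V t \<and> j \<in> V t"
      using ij k by (intro exI[of _ "max i j - w"]) (auto simp: V_def max_def)
    with ij show ?thesis by (auto simp: G_def bag_graph_def)
  qed
  \<comment> \<open>The columns e_(w+1+a) - e_w form a basis of the span of all differences among
    the \<open>l + 1\<close> vertices from \<open>w\<close> to \<open>w + l\<close>.\<close>
  define F :: "real mat" where
    "F = mat n l (\<lambda>(p, a). (if p = w + 1 + a then 1 else 0) - (if p = w then 1 else 0))"
  have F: "F \<in> carrier_mat n l" by (simp add: F_def)
  define C where "C = (\<lambda>(i, j). (elem_sym n i j, 2 * (if i = j then 1 else 0 :: real))) ` ({..<?N} \<times> {..<?N})"
  have low_rank: "\<exists>S\<in>sparse_sym_mats n G. \<exists>K\<in>carrier_mat l n. elem_sym n i j = S + F * K"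
    if ij: "i < ?N" "j < ?N" for i j
  proof (cases "i = j \<or> i < w \<or> j < w")
    case True
    then have "i = j \<or> (i, j) \<in> parcs G" using edge[of i j] ij assms by auto
    then show ?thesis by (rule elem_sym_sparse_plus_low_rank[OF _ G F])
  next
    case False
    then have ij': "i \<noteq> j" "w \<le> i" "w \<le> j" by auto
    \<comment> \<open>Coordinates of d = e_i - e_j in the columns of \<open>F\<close>; an index
      equal to \<open>w\<close> contributes nothing, as e_w is the common base point. With these,
      \<open>F * K\<close> is minus the outer product of d with itself.\<close>
    define g where "g a = (if i = w + 1 + a then 1 else 0) - (if j = w + 1 + a then 1 else 0 :: real)" for a
    define d where "d p = (if p = i then 1 else 0) - (if p = j then 1 else 0 :: real)" for p
    define S where "S = mat n n (\<lambda>(p, q). if p = q \<and> (p = i \<or> p = j) then 1 else 0 :: real)"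
    define K where "K = mat l n (\<lambda>(a, q). - g a * d q)"
    have "S\<^sup>T = S" by (rule eq_matI) (auto simp: S_def)
    then have S: "S \<in> sparse_sym_mats n G"
      by (auto simp: S_def sparse_sym_mats_def sym_mats_def)
    have h: "(\<Sum>a = 0..<l. F $$ (p, a) * (if i = w + 1 + a then 1 else 0)) =
      (if p = i then 1 else 0) - (if p = w then 1 else 0)" if "w \<le> i" "i < ?N" "p < n" for i p
    proof (cases "i = w")
      case False
      have "(\<Sum>a = 0..<l. F $$ (p, a) * (if i = w + 1 + a then 1 else 0)) =
        (\<Sum>a = 0..<l. if a = i - w - 1 then F $$ (p, a) else 0)"
        using that False by (intro sum.cong) auto
      also have "\<dots> = F $$ (p, i - w - 1)" using that False by simp
      also have "\<dots> = (if p = i then 1 else 0) - (if p = w then 1 else 0)"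
        using that False by (auto simp: F_def)
      finally show ?thesis .
    qed auto
    have Fg: "(\<Sum>a = 0..<l. F $$ (p, a) * g a) = d p" if "p < n" for p
      using h[of i p] h[of j p] ij ij' that
      by (simp add: g_def d_def right_diff_distrib sum_subtractf)
    have "elem_sym n i j = S + F * K"
    proof (rule eq_matI)
      fix p q assume "p < dim_row (S + F * K)" "q < dim_col (S + F * K)"
      then have pq: "p < n" "q < n" using F by (auto simp: S_def K_def)
      have "(F * K) $$ (p, q) = (\<Sum>a = 0..<l. F $$ (p, a) * (- g a * d q))"
        using F pq by (simp add: K_def scalar_prod_def)
      also have "\<dots> = - ((\<Sum>a = 0..<l. F $$ (p, a) * g a) * d q)"
        by (simp add: sum_distrib_right sum_negf mult.assoc)
      finally have "(F * K) $$ (p, q) = - d p * d q" using Fg pq by simp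
      then show "elem_sym n i j $$ (p, q) = (S + F * K) $$ (p, q)"
        using pq F ij' by (auto simp: elem_sym_def S_def d_def K_def)
    qed (use F in \<open>auto simp: elem_sym_def S_def K_def\<close>)
    moreover have "K \<in> carrier_mat l n" by (simp add: K_def)
    ultimately show ?thesis using S by blast
  qed
  obtain P where P: "sdp_problem n P" "splr n G l P"
    "sdp_optimal n P = {X \<in> psd_mats n. \<forall>(A, b)\<in>C. trace_inner A X = b}"
  proof (rule sdp_of_equations[of C F n l G])
    show "finite C" by (simp add: C_def)
    show "A \<in> sym_mats n \<and> (\<exists>S\<in>sparse_sym_mats n G. \<exists>K\<in>carrier_mat l n. A = S + F * K)"
      if "(A, b) \<in> C" for A b
      using that low_rank elem_sym_in_sym_mats by (auto simp: C_def)
  qed (use F in auto)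
  have entry: "(\<forall>(A, b)\<in>C. trace_inner A X = b) \<longleftrightarrow>
      (\<forall>i<?N. \<forall>j<?N. X $$ (i, j) = (if i = j then 1 else 0))" if "X \<in> psd_mats n" for X
    using that assms trace_inner_elem_sym[of X n] by (auto simp: C_def psd_mats_def)
  have "1\<^sub>m n \<in> sdp_optimal n P"
    using P(3) one_mat_psd entry[OF one_mat_psd] assms by auto
  moreover have "mat_rank X \<ge> ?N" if "X \<in> sdp_optimal n P" for X
  proof -
    have "X \<in> psd_mats n" and "\<forall>i<?N. \<forall>j<?N. X $$ (i, j) = (if i = j then 1 else 0)"
      using that P(3) entry by auto
    \<comment> \<open>The block bound is applied with an empty second block.\<close>
    then have "?N + mat_rank (1\<^sub>m 0) \<le> mat_rank X"
      using assms by (intro mat_rank_block_diag_ge[of X n "1\<^sub>m 0" 0]) (auto simp: psd_mats_def sym_mats_def)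
    then show ?thesis by simp
  qed
  ultimately show ?thesis
    using P G width by (intro exI[of _ P] exI[of _ G]) auto
qed

section \<open>Forcing a rank of treewidth plus phi\<close>

lemma left_kernel_trivial:
  fixes W :: "real mat"
  assumes W: "W \<in> carrier_mat l l" and det: "det W \<noteq> 0"
    and z: "\<And>a. a < l \<Longrightarrow> (\<Sum>b = 0..<l. z b * W $$ (b, a)) = 0" and "b < l"
  shows "z b = 0"
proof -
  have WT: "W\<^sup>T \<in> carrier_mat l l" using W by simp
  have "W\<^sup>T *\<^sub>v vec l z = 0\<^sub>v l"
  proof (rule eq_vecI)
    fix a assume "a < dim_vec (0\<^sub>v l :: real vec)"
    with z[of a] W show "(W\<^sup>T *\<^sub>v vec l z) $ a = 0\<^sub>v l $ a"
      by (simp add: scalar_prod_def mult.commute)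
  qed (use W in simp)
  moreover have "det W\<^sup>T \<noteq> 0" using det det_transpose[OF W] by simp
  ultimately have "vec l z = 0\<^sub>v l"
    using det_0_iff_vec_prod_zero[OF WT] vec_carrier[of l z] by blast
  then have "vec l z $ b = 0\<^sub>v l $ b" by simp
  with \<open>b < l\<close> show ?thesis by simp
qed

text \<open>Rows of \<open>X\<close> are grouped into a clique \<open>{..<c}\<close> and three blocks
  $P_1, P_2, P_3$ of size \<open>l\<close> starting at \<open>c\<close>. The assumption \<open>kernel\<close> says that \<open>X\<close> annihilates
  the columns of $(0; U; I)$. Row \<open>i\<close> of the clique misses at most one of the blocks in the
  sparsity pattern, and invertibility of the blocks of \<open>U\<close> makes the missing entries vanish.\<close>

lemma clique_rows_vanish:
  fixes X U :: "real mat"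
  assumes "i < c"
    and e1: "\<And>b. \<not> i < l \<Longrightarrow> b < l \<Longrightarrow> X $$ (i, c + b) = 0"
    and e2: "\<And>b. \<not> (l \<le> i \<and> i < 2 * l) \<Longrightarrow> b < l \<Longrightarrow> X $$ (i, c + l + b) = 0"
    and e3: "\<And>b. \<not> (2 * l \<le> i \<and> i < 3 * l) \<Longrightarrow> b < l \<Longrightarrow> X $$ (i, c + 2 * l + b) = 0"
    and kernel: "\<And>a. a < l \<Longrightarrow> (\<Sum>b = 0..<2 * l. X $$ (i, c + b) * U $$ (b, a)) + X $$ (i, c + 2 * l + a) = 0"
    and det: "det (mat l l (\<lambda>(i, j). U $$ (i, j))) \<noteq> 0" "det (mat l l (\<lambda>(i, j). U $$ (l + i, j))) \<noteq> 0"
    and "b < 2 * l"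
  shows "X $$ (i, c + b) = 0"
proof -
  have split: "(\<Sum>b = 0..<l. X $$ (i, c + b) * U $$ (b, a)) +
      (\<Sum>b = 0..<l. X $$ (i, c + l + b) * U $$ (l + b, a)) + X $$ (i, c + 2 * l + a) = 0" if "a < l" for a
    using kernel[OF that] sum_two_blocks[of l l "2 * l" "\<lambda>b. X $$ (i, c + b) * U $$ (b, a)"]
    by (simp add: add.assoc)
  have 1: "X $$ (i, c + b) = 0" if "b < l" for b
  proof (cases "i < l")
    case True
    \<comment> \<open>The other two blocks vanish on such a row, so the kernel relation leaves a row
      vector annihilated by the invertible upper block of \<open>U\<close>.\<close>
    have "(\<Sum>b = 0..<l. X $$ (i, c + b) * mat l l (\<lambda>(i, j). U $$ (i, j)) $$ (b, a)) = 0" if "a < l" for a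
      using split[OF that] that e2 e3 True by simp
    from left_kernel_trivial[OF _ det(1) this \<open>b < l\<close>] show ?thesis by simp
  qed (use e1 that in blast)
  moreover have 2: "X $$ (i, c + l + b) = 0" if "b < l" for b
  proof (cases "l \<le> i \<and> i < 2 * l")
    case True
    have "(\<Sum>b = 0..<l. X $$ (i, c + l + b) * mat l l (\<lambda>(i, j). U $$ (l + i, j)) $$ (b, a)) = 0" if "a < l" for a
      using split[OF that] that e1 e3 True by simp
    from left_kernel_trivial[OF _ det(2) this \<open>b < l\<close>] show ?thesis by simp
  qed (use e2 that in blast)
  ultimately show ?thesis
    using \<open>b < 2 * l\<close> 1[of b] 2[of "b - l"] by (cases "b < l") auto
qed

text \<open>The witness \<open>Y\<close> is the principal submatrix of \<open>X\<close> on the first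
  two blocks. These are orthogonal to the clique, so \<open>X\<close> contains the direct sum of an
  identity of size \<open>c\<close> and \<open>Y\<close>.\<close>

lemma rank_ge_of_kernel:
  fixes X U :: "real mat"
  assumes U: "U \<in> carrier_mat (2 * l) l" and M: "M \<in> sym_mats l"
    and det: "det (mat l l (\<lambda>(i, j). U $$ (i, j))) \<noteq> 0" "det (mat l l (\<lambda>(i, j). U $$ (l + i, j))) \<noteq> 0"
    and X: "X \<in> psd_mats n" and n: "c + 3 * l \<le> n"
    and one: "\<And>i j. i < c \<Longrightarrow> j < c \<Longrightarrow> X $$ (i, j) = (if i = j then 1 else 0)"
    and e1: "\<And>i b. i < c \<Longrightarrow> \<not> i < l \<Longrightarrow> b < l \<Longrightarrow> X $$ (i, c + b) = 0"
    and e2: "\<And>i b. i < c \<Longrightarrow> \<not> (l \<le> i \<and> i < 2 * l) \<Longrightarrow> b < l \<Longrightarrow> X $$ (i, c + l + b) = 0"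
    and e3: "\<And>i b. i < c \<Longrightarrow> \<not> (2 * l \<le> i \<and> i < 3 * l) \<Longrightarrow> b < l \<Longrightarrow> X $$ (i, c + 2 * l + b) = 0"
    and P1: "\<And>i j. i < l \<Longrightarrow> j < l \<Longrightarrow> X $$ (c + i, c + j) = (if i = j then 1 else 0)"
    and P2: "\<And>i j. i < l \<Longrightarrow> j < l \<Longrightarrow> X $$ (c + l + i, c + l + j) = (if i = j then 1 else 0)"
    and P3: "\<And>i j. i < l \<Longrightarrow> j < l \<Longrightarrow> X $$ (c + 2 * l + i, c + 2 * l + j) = M $$ (i, j)"
    and kernel: "\<And>i a. i < n \<Longrightarrow> a < l \<Longrightarrow>
      (\<Sum>b = 0..<2 * l. X $$ (i, c + b) * U $$ (b, a)) + X $$ (i, c + 2 * l + a) = 0"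
  shows "\<exists>Y\<in>phi_set l U M. c + mat_rank Y \<le> mat_rank X"
proof -
  have Xc: "X \<in> carrier_mat n n" and Xsym: "X \<in> sym_mats n"
    using X by (auto simp: psd_mats_def sym_mats_def)
  have C0: "X $$ (i, c + b) = 0" if i: "i < c" and b: "b < 2 * l" for i b
  proof (rule clique_rows_vanish[where X = X and U = U and l = l, OF i _ _ _ _ det b])
    show "(\<Sum>b = 0..<2 * l. X $$ (i, c + b) * U $$ (b, a)) + X $$ (i, c + 2 * l + a) = 0" if "a < l" for a
      using kernel[of i a] that i n by simp
  qed (use i e1 e2 e3 in auto)
  \<comment> \<open>\<open>J\<close> embeds the coordinates of the first two blocks, which makes
    positivity of the submatrix an instance of congruence.\<close>
  define J :: "real mat" where "J = mat n (2 * l) (\<lambda>(p, b). if p = c + b then 1 else 0)"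
  have J: "J \<in> carrier_mat n (2 * l)" by (simp add: J_def)
  define Y where "Y = J\<^sup>T * X * J"
  have Ypsd: "Y \<in> psd_mats (2 * l)" unfolding Y_def using X J by (rule congruence_psd)
  then have Yc: "Y \<in> carrier_mat (2 * l) (2 * l)" by (simp add: psd_mats_def sym_mats_def)
  have YX: "Y $$ (b, b') = X $$ (c + b, c + b')" if "b < 2 * l" "b' < 2 * l" for b b'
  proof -
    have J_col: "col J b = unit_vec n (c + b)" if "b < 2 * l" for b
      using that n by (intro eq_vecI) (auto simp: J_def unit_vec_def)
    then have "Y $$ (b, b') = unit_vec n (c + b) \<bullet> (X *\<^sub>v unit_vec n (c + b'))"
      unfolding Y_def using congruence_entry[OF Xc J] that by simp
    also have "\<dots> = X $$ (c + b, c + b')"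
      using that n by (intro unit_vec_bilinear[OF Xc]) auto
    finally show ?thesis .
  qed
  have "U\<^sup>T * Y * U = M"
  proof (rule eq_matI)
    fix a a' assume "a < dim_row M" "a' < dim_col M"
    then have a: "a < l" "a' < l" using M by (auto simp: sym_mats_def)
    \<comment> \<open>The kernel relation is used twice: on rows of the first two blocks it replaces
      \<open>Y\<close> times a column of \<open>U\<close> by negated entries against the third
      block, and on rows of the third block it then leads to \<open>M\<close>.\<close>
    have row: "(\<Sum>b' = 0..<2 * l. X $$ (c + b, c + b') * U $$ (b', a')) = - X $$ (c + 2 * l + a', c + b)"
      if "b < 2 * l" for b
      using kernel[of "c + b" a'] that n a sym_matsD[OF Xsym, of "c + b" "c + 2 * l + a'"] by simp
    have "(U\<^sup>T * Y * U) $$ (a, a') = (\<Sum>b = 0..<2 * l. U $$ (b, a) * (\<Sum>b' = 0..<2 * l. X $$ (c + b, c + b') * U $$ (b', a')))"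
      using congruence_entry[OF Yc U a] U Yc a YX by (simp add: scalar_prod_def)
    also have "\<dots> = - (\<Sum>b = 0..<2 * l. X $$ (c + 2 * l + a', c + b) * U $$ (b, a))"
      using row by (simp add: sum_negf mult.commute)
    also have "\<dots> = M $$ (a', a)"
      using kernel[of "c + 2 * l + a'" a] a n P3[of a' a] by simp
    also have "\<dots> = M $$ (a, a')" using sym_matsD[OF M a] .
    finally show "(U\<^sup>T * Y * U) $$ (a, a') = M $$ (a, a')" .
  qed (use U M in \<open>auto simp: sym_mats_def\<close>)
  then have "Y \<in> phi_set l U M"
  proof (rule phi_setI[OF Ypsd])
    fix i j assume "i < l" "j < l"
    then show "Y $$ (i, j) = (if i = j then 1 else 0)" "Y $$ (l + i, l + j) = (if i = j then 1 else 0)"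
      using YX[of i j] YX[of "l + i" "l + j"] P1 P2 by (simp_all add: add.assoc)
  qed
  moreover have "c + mat_rank Y \<le> mat_rank X"
  proof (rule mat_rank_block_diag_ge[OF Xc Yc])
    fix i j assume "i < c" "j < 2 * l"
    then show "X $$ (i, c + j) = 0 \<and> X $$ (c + j, i) = 0"
      using C0[of i j] sym_matsD[OF Xsym, of i "c + j"] n by simp
  qed (use n one YX in auto)
  ultimately show ?thesis by blast
qed

text \<open>The bound \<open>3 * l \<le> Suc w\<close> makes room for three disjoint
  \<open>l\<close>-subsets in a clique of \<open>w + 1\<close> vertices, and the bound on
  \<open>n\<close> leaves \<open>3 * l\<close> vertices outside it.\<close>

lemma sdp_rank_treewidth:
  assumes "l > 0" and w: "3 * l \<le> Suc w" and n: "w + 3 * l + 1 \<le> n"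
  shows "\<exists>P G. sdp_problem n P \<and> graph_on n G \<and> splr n G l P \<and>
    treewidth G = w \<and> sdp_optimal n P \<noteq> {} \<and>
    (\<forall>X\<in>sdp_optimal n P. mat_rank X \<ge> treewidth G + phi l + 1)"
proof -
  define c where "c = Suc w"
  have c: "3 * l \<le> c" "c + 3 * l \<le> n" using w n by (auto simp: c_def)

  \<comment> \<open>Extremal data with invertible blocks\<close>
  obtain U0 M0 Y0 where U0: "U0 \<in> carrier_mat (2 * l) l" "Y0 \<in> phi_set l U0 M0"
    "\<And>Y. Y \<in> phi_set l U0 M0 \<Longrightarrow> phi l \<le> mat_rank Y"
    using phi_attained[OF \<open>l > 0\<close>] by (metis ex_in_conv)
  obtain U Y where U: "U \<in> carrier_mat (2 * l) l" and Y: "Y \<in> phi_set l U (U\<^sup>T * Y * U)"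
    and rank: "\<And>Y'. Y' \<in> phi_set l U (U\<^sup>T * Y * U) \<Longrightarrow> phi l \<le> mat_rank Y'"
    and det: "det (mat l l (\<lambda>(i, j). U $$ (i, j))) \<noteq> 0" "det (mat l l (\<lambda>(i, j). U $$ (l + i, j))) \<noteq> 0"
    using phi_set_invertible_blocks[OF U0] by metis
  define M where "M = U\<^sup>T * Y * U"
  have Ypsd: "Y \<in> psd_mats (2 * l)" using Y by (simp add: phi_set_def)
  then have Ysym: "Y \<in> sym_mats (2 * l)" and Yc: "Y \<in> carrier_mat (2 * l) (2 * l)"
    by (auto simp: psd_mats_def sym_mats_def)
  have M: "M \<in> sym_mats l" unfolding M_def using Ysym U by (rule congruence_sym)

  \<comment> \<open>The star of bags and its graph\<close>
  define B where "B a = ({..<c} - {a..<a + l}) \<union> {c + a..<c + a + l}" for a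
  \<comment> \<open>\<open>B 0\<close>, \<open>B l\<close> and \<open>B (2 * l)\<close> each trade
    an \<open>l\<close>-subset of the clique for one outer block. Vertices beyond the blocks get
    singleton bags and stay isolated.\<close>
  define V where "V t = (if t = 0 then {..<c} else if t = 1 then B 0 else if t = 2 then B l
    else if t = 3 then B (2 * l) else {c + 3 * l + (t - 4)})" for t
  define k where "k = 4 + (n - (c + 3 * l))"
  define G where "G = bag_graph n k V"
  have k: "k > 0" by (simp add: k_def)
  have cardB: "card (B a) = c" if "a + l \<le> c" for a
  proof -
    have "card (B a) = card ({..<c} - {a..<a + l}) + card {c + a..<c + a + l}"
      unfolding B_def by (rule card_Un_disjoint) auto
    also have "card ({..<c} - {a..<a + l}) = c - l"
      using that by (subst card_Diff_subset) auto
    finally show ?thesis using that by simp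
  qed
  have td: "tree_decomposition G (parent_tree k (\<lambda>_. 0)) V"
    unfolding G_def
  proof (rule tree_decomposition_parent_tree[OF k])
    show "V t \<subseteq> {..<n}" if "t < k" for t
      using that c by (auto simp: V_def B_def k_def)
    show "{..<n} \<subseteq> (\<Union>t<k. V t)"
    proof
      fix x assume x: "x \<in> {..<n}"
      consider "x < c" | "c \<le> x" "x < c + l" | "c + l \<le> x" "x < c + 2 * l"
        | "c + 2 * l \<le> x" "x < c + 3 * l" | "c + 3 * l \<le> x" by linarith
      then have "\<exists>t<k. x \<in> V t"
      proof cases
        case 5
        then show ?thesis using x by (intro exI[of _ "x - (c + 3 * l) + 4"]) (auto simp: V_def k_def)
      next
        case 1
        then show ?thesis by (intro exI[of _ 0]) (simp add: V_def k_def)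
      next
        case 2
        then show ?thesis by (intro exI[of _ 1]) (simp add: V_def B_def k_def)
      next
        case 3
        then show ?thesis by (intro exI[of _ 2]) (simp add: V_def B_def k_def)
      next
        case 4
        then show ?thesis by (intro exI[of _ 3]) (simp add: V_def B_def k_def)
      qed
      then show "x \<in> (\<Union>t<k. V t)" by blast
    qed
    show "V (hd p) \<inter> V (last p) \<subseteq> V t"
      if p: "vpath p (with_proj (parent_tree k (\<lambda>_. 0)))" "t \<in> set p" "hd p \<noteq> last p" "t \<noteq> hd p" "t \<noteq> last p" for p t
    proof -
      have "t = 0" using star_tree_interior p by blast
      \<comment> \<open>Different bags meet only inside the clique, which is the bag at the
        centre.\<close>
      moreover have "V r \<inter> V s \<subseteq> {..<c}" if "r \<noteq> s" for r s
        using that by (auto simp: V_def B_def split: if_splits)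
      ultimately show ?thesis using p(3) by (simp add: V_def)
    qed
  qed simp
  have tw: "treewidth G = w"
    unfolding G_def
  proof (rule bag_graph_width(1)[OF td[unfolded G_def] k])
    show "card (V t) \<le> Suc w" for t
      using cardB[of 0] cardB[of l] cardB[of "2 * l"] c by (auto simp: V_def c_def)
  qed (simp add: V_def c_def)
  have G: "graph_on n G" by (simp add: G_def graph_on_bag_graph)
  have edge: "i = j \<or> (i, j) \<in> parcs G" if "i < n" "j < n" "t < 4" "i \<in> V t" "j \<in> V t" for i j t
  proof -
    have "t < k" using that by (simp add: k_def)
    with that show ?thesis unfolding G_def bag_graph_def by auto
  qed

  \<comment> \<open>A feasible matrix with the columns of \<open>F\<close> in its kernel\<close>
  define K where "K = mat (2 * l) (n - c) (\<lambda>(b, q). if q < 2 * l then (if b = q then 1 else 0)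
    else if q < 3 * l then - U $$ (b, q - 2 * l) else 0)"
  \<comment> \<open>\<open>K\<close> has the block form (I, -U, 0): \<open>Z\<close> is the Gram
    matrix obtained from \<open>Y\<close> by appending the negated combinations given by
    \<open>U\<close>, followed by zero vectors. Its third diagonal block is therefore
    \<open>M\<close>.\<close>
  define Z where "Z = K\<^sup>T * Y * K"
  define X0 where "X0 = four_block_mat (1\<^sub>m c) (0\<^sub>m c (n - c)) (0\<^sub>m (n - c) c) Z"
  define F where "F = mat n l (\<lambda>(p, a). if p < c then 0 else if p < c + 2 * l then U $$ (p - c, a)
    else if p = c + 2 * l + a then 1 else 0)"
  have K: "K \<in> carrier_mat (2 * l) (n - c)" by (simp add: K_def)
  have Zpsd: "Z \<in> psd_mats (n - c)" unfolding Z_def using Ypsd K by (rule congruence_psd)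
  then have Zc: "Z \<in> carrier_mat (n - c) (n - c)" by (simp add: psd_mats_def sym_mats_def)
  have X0psd: "X0 \<in> psd_mats n"
    using block_diag_one_psd[OF Zpsd, of c] c by (simp add: X0_def)
  then have X0sym: "X0 \<in> sym_mats n" and X0c: "X0 \<in> carrier_mat n n"
    by (auto simp: psd_mats_def sym_mats_def)
  have F: "F \<in> carrier_mat n l" by (simp add: F_def)
  have X0_entry: "X0 $$ (i, j) = (if i < c then (if i = j then 1 else 0) else if j < c then 0
    else Z $$ (i - c, j - c))" if "i < n" "j < n" for i j
    using that c Zc by (auto simp: X0_def)
  have K_unit: "col K q = unit_vec (2 * l) q" if "q < 2 * l" for q
    using that c by (intro eq_vecI) (auto simp: K_def unit_vec_def)
  have K_U: "col K (2 * l + a) = - col U a" if "a < l" for a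
    using that c U by (intro eq_vecI) (auto simp: K_def)
  have Z1: "Z $$ (b, b') = Y $$ (b, b')" if "b < 2 * l" "b' < 2 * l" for b b'
  proof -
    have "Z $$ (b, b') = unit_vec (2 * l) b \<bullet> (Y *\<^sub>v unit_vec (2 * l) b')"
      unfolding Z_def using that c congruence_entry[OF Yc K, of b b'] by (simp add: K_unit)
    then show ?thesis using unit_vec_bilinear[OF Yc that] by simp
  qed
  have Z3: "Z $$ (2 * l + a, 2 * l + a') = M $$ (a, a')" if a: "a < l" "a' < l" for a a'
  proof -
    have cU: "col U q \<in> carrier_vec (2 * l)" for q using U col_dim[of U q] by simp
    have YU: "Y *\<^sub>v col U a' \<in> carrier_vec (2 * l)" using Yc cU by (rule mult_mat_vec_carrier)
    have neg: "Y *\<^sub>v (- col U a') = - (Y *\<^sub>v col U a')"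
      using Yc cU[of a'] by (intro eq_vecI) (auto simp: scalar_prod_def sum_negf)
    have "Z $$ (2 * l + a, 2 * l + a') = (- col U a) \<bullet> (Y *\<^sub>v (- col U a'))"
      unfolding Z_def using a c congruence_entry[OF Yc K, of "2 * l + a" "2 * l + a'"] by (simp add: K_U)
    also have "\<dots> = col U a \<bullet> (Y *\<^sub>v col U a')"
      unfolding neg using carrier_vecD[OF cU[of a]] carrier_vecD[OF YU] by simp
    finally show ?thesis using congruence_entry[OF Yc U a] by (simp add: M_def)
  qed
  have colF: "col F a \<bullet> (X0 *\<^sub>v col F a) = 0" if a: "a < l" for a
  proof -
    \<comment> \<open>The part of the column of \<open>F\<close> below the clique; in
      \<open>K *\<^sub>v g\<close> the column of \<open>U\<close> occurs once with each
      sign.\<close>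
    define g where "g = vec (n - c) (\<lambda>p. if p < 2 * l then U $$ (p, a) else if p = 2 * l + a then 1 else 0)"
    have g: "g \<in> carrier_vec (n - c)" by (simp add: g_def)
    have Fg: "col F a = 0\<^sub>v c @\<^sub>v g"
      using a c by (intro eq_vecI) (auto simp: F_def g_def)
    have "K *\<^sub>v g = 0\<^sub>v (2 * l)"
    proof (rule eq_vecI)
      fix b assume "b < dim_vec (0\<^sub>v (2 * l) :: real vec)"
      then have b: "b < 2 * l" by simp
      have "(K *\<^sub>v g) $ b = (\<Sum>q = 0..<n - c. K $$ (b, q) * g $ q)"
        using b K g by (simp add: scalar_prod_def)
      also have "\<dots> = (\<Sum>q = 0..<2 * l. K $$ (b, q) * g $ q) + (\<Sum>q = 0..<l. K $$ (b, 2 * l + q) * g $ (2 * l + q))"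
        using b c by (intro sum_two_blocks) (auto simp: K_def)
      also have "(\<Sum>q = 0..<2 * l. K $$ (b, q) * g $ q) = (\<Sum>q = 0..<2 * l. if b = q then U $$ (q, a) else 0)"
        using b c by (intro sum.cong) (auto simp: K_def g_def)
      also have "\<dots> = U $$ (b, a)" using b by simp
      also have "(\<Sum>q = 0..<l. K $$ (b, 2 * l + q) * g $ (2 * l + q)) = (\<Sum>q = 0..<l. if q = a then - U $$ (b, q) else 0)"
        using b c by (intro sum.cong) (auto simp: K_def g_def)
      also have "\<dots> = - U $$ (b, a)" using a by simp
      finally show "(K *\<^sub>v g) $ b = 0\<^sub>v (2 * l) $ b" using b by simp
    qed (use K in simp)
    then have "g \<bullet> (Z *\<^sub>v g) = 0"
      unfolding Z_def congruence_quadratic[OF Yc K g] using Yc by simp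
    then show ?thesis
      unfolding Fg X0_def using block_diag_one_quadratic[OF Zc zero_carrier_vec[of c] g] by simp
  qed

  \<comment> \<open>The constraints: one of low rank, the others sparse\<close>
  define C where "C = insert (F * F\<^sup>T, 0) ((\<lambda>(i, j). (elem_sym n i j, 2 * X0 $$ (i, j))) `
    {(i, j). i < n \<and> j < n \<and> (i = j \<or> (i, j) \<in> parcs G)})"
  obtain P where P: "sdp_problem n P" "splr n G l P"
    "sdp_optimal n P = {X \<in> psd_mats n. \<forall>(A, b)\<in>C. trace_inner A X = b}"
  proof (rule sdp_of_equations[of C F n l G])
    have "finite {(i, j). i < n \<and> j < n \<and> (i = j \<or> (i, j) \<in> parcs G)}"
      by (rule finite_subset[of _ "{..<n} \<times> {..<n}"]) auto
    then show "finite C" by (simp add: C_def)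
    show "A \<in> sym_mats n \<and> (\<exists>S\<in>sparse_sym_mats n G. \<exists>K\<in>carrier_mat l n. A = S + F * K)"
      if "(A, b) \<in> C" for A b
    proof -
      have FT: "F\<^sup>T \<in> carrier_mat l n" using F by simp
      have "(F * F\<^sup>T)\<^sup>T = F * F\<^sup>T" using transpose_mult[OF F FT] by simp
      then have "F * F\<^sup>T \<in> sym_mats n" using F by (simp add: sym_mats_def)
      moreover have "F * F\<^sup>T = 0\<^sub>m n n + F * F\<^sup>T" using F by simp
      moreover have "0\<^sub>m n n \<in> sparse_sym_mats n G" by (simp add: sparse_sym_mats_def sym_mats_def)
      ultimately have "F * F\<^sup>T \<in> sym_mats n \<and>
          (\<exists>S\<in>sparse_sym_mats n G. \<exists>K\<in>carrier_mat l n. F * F\<^sup>T = S + F * K)"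
        using FT by blast
      moreover have "elem_sym n i j \<in> sym_mats n \<and>
          (\<exists>S\<in>sparse_sym_mats n G. \<exists>K\<in>carrier_mat l n. elem_sym n i j = S + F * K)"
        if "i = j \<or> (i, j) \<in> parcs G" for i j
        using elem_sym_in_sym_mats elem_sym_sparse_plus_low_rank[OF that G F] by blast
      ultimately show ?thesis using that by (auto simp: C_def)
    qed
  qed (use F in auto)

  have "trace_inner (F * F\<^sup>T) X0 = 0"
    unfolding trace_inner_gram[OF F X0c] using colF by simp
  then have "X0 \<in> sdp_optimal n P"
    using P(3) X0psd trace_inner_elem_sym[OF X0sym] by (auto simp: C_def)

  \<comment> \<open>The rank of an optimal matrix\<close>
  moreover have "mat_rank X \<ge> w + phi l + 1" if X: "X \<in> sdp_optimal n P" for X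
  proof -
    have Xpsd: "X \<in> psd_mats n" and XC: "\<forall>(A, b)\<in>C. trace_inner A X = b" using X P(3) by auto
    then have Xsym: "X \<in> sym_mats n" and Xc: "X \<in> carrier_mat n n"
      and nonneg: "\<And>v. v \<in> carrier_vec n \<Longrightarrow> 0 \<le> v \<bullet> (X *\<^sub>v v)"
      by (auto simp: psd_mats_def sym_mats_def)
    \<comment> \<open>The program fixes every entry whose two indices share one of the first four
      bags; \<open>t\<close> names such a bag, \<open>0\<close> for the clique and \<open>1\<close>,
      \<open>2\<close>, \<open>3\<close> for the outer blocks.\<close>
    have eq: "X $$ (i, j) = X0 $$ (i, j)" if "i < n" "j < n" "t < 4" "i \<in> V t" "j \<in> V t" for i j t
    proof -
      have "(elem_sym n i j, 2 * X0 $$ (i, j)) \<in> C"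
        using edge[OF that] that(1,2) unfolding C_def by auto
      then have "trace_inner (elem_sym n i j) X = 2 * X0 $$ (i, j)" using XC by fast
      then show ?thesis using trace_inner_elem_sym[OF Xsym that(1,2)] by simp
    qed
    have kernel: "(\<Sum>b = 0..<2 * l. X $$ (i, c + b) * U $$ (b, a)) + X $$ (i, c + 2 * l + a) = 0"
      if i: "i < n" and a: "a < l" for i a
    proof -
      have "(F * F\<^sup>T, 0) \<in> C" by (simp add: C_def)
      then have "trace_inner (F * F\<^sup>T) X = 0" using XC by fast
      then have "(\<Sum>a = 0..<l. col F a \<bullet> (X *\<^sub>v col F a)) = 0"
        using trace_inner_gram[OF F Xc] by simp
      moreover have colFc: "col F a \<in> carrier_vec n" for a using F col_dim[of F a] by simp
      \<comment> \<open>A vanishing sum of nonnegative terms vanishes termwise, and a zero of a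
        positive semidefinite form lies in its kernel.\<close>
      ultimately have "col F a \<bullet> (X *\<^sub>v col F a) = 0"
        using a nonneg by (subst (asm) sum_nonneg_eq_0_iff) auto
      then have "X *\<^sub>v col F a = 0\<^sub>v n" using psd_kernel[OF Xpsd colFc] by simp
      then have "(X *\<^sub>v col F a) $ i = 0" using i by simp
      then have "(\<Sum>j = 0..<n. X $$ (i, j) * F $$ (j, a)) = 0"
        using i a Xc F by (simp add: scalar_prod_def)
      also have "(\<Sum>j = 0..<n. X $$ (i, j) * F $$ (j, a)) = (\<Sum>j = 0..<c. X $$ (i, j) * F $$ (j, a)) +
          (\<Sum>j = 0..<3 * l. X $$ (i, c + j) * F $$ (c + j, a))"
        using a c by (intro sum_two_blocks) (auto simp: F_def)
      also have "(\<Sum>j = 0..<c. X $$ (i, j) * F $$ (j, a)) = 0"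
        using a c by (intro sum.neutral) (auto simp: F_def)
      also have "(\<Sum>j = 0..<3 * l. X $$ (i, c + j) * F $$ (c + j, a)) =
          (\<Sum>j = 0..<2 * l. X $$ (i, c + j) * F $$ (c + j, a)) +
          (\<Sum>j = 0..<l. X $$ (i, c + (2 * l + j)) * F $$ (c + (2 * l + j), a))"
        by (intro sum_two_blocks) auto
      also have "(\<Sum>j = 0..<2 * l. X $$ (i, c + j) * F $$ (c + j, a)) =
          (\<Sum>j = 0..<2 * l. X $$ (i, c + j) * U $$ (j, a))"
        using a c by (intro sum.cong) (auto simp: F_def)
      also have "(\<Sum>j = 0..<l. X $$ (i, c + (2 * l + j)) * F $$ (c + (2 * l + j), a)) =
          (\<Sum>j = 0..<l. if j = a then X $$ (i, c + 2 * l + j) else 0)"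
        using a c by (intro sum.cong) (auto simp: F_def add.assoc)
      also have "\<dots> = X $$ (i, c + 2 * l + a)" using a by simp
      finally show ?thesis by simp
    qed
    have "\<exists>Y'\<in>phi_set l U M. c + mat_rank Y' \<le> mat_rank X"
    proof (rule rank_ge_of_kernel[OF U M det Xpsd c(2) _ _ _ _ _ _ _ kernel])
      show "X $$ (i, j) = (if i = j then 1 else 0)" if "i < c" "j < c" for i j
        using that c eq[of i j 0] X0_entry[of i j] by (simp add: V_def)
      show "X $$ (i, c + b) = 0" if "i < c" "\<not> i < l" "b < l" for i b
        using that c eq[of i "c + b" 1] X0_entry[of i "c + b"] by (simp add: V_def B_def)
      show "X $$ (i, c + l + b) = 0" if "i < c" "\<not> (l \<le> i \<and> i < 2 * l)" "b < l" for i b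
        using that c eq[of i "c + l + b" 2] X0_entry[of i "c + l + b"] by (auto simp: V_def B_def)
      show "X $$ (i, c + 2 * l + b) = 0" if "i < c" "\<not> (2 * l \<le> i \<and> i < 3 * l)" "b < l" for i b
        using that c eq[of i "c + 2 * l + b" 3] X0_entry[of i "c + 2 * l + b"] by (auto simp: V_def B_def)
      show "X $$ (c + i, c + j) = (if i = j then 1 else 0)" if "i < l" "j < l" for i j
        using that c eq[of "c + i" "c + j" 1] X0_entry[of "c + i" "c + j"] Z1[of i j] phi_set_blocks(1)[OF Y that]
        by (simp add: V_def B_def)
      show "X $$ (c + l + i, c + l + j) = (if i = j then 1 else 0)" if "i < l" "j < l" for i j
        using that c eq[of "c + l + i" "c + l + j" 2] X0_entry[of "c + l + i" "c + l + j"] Z1[of "l + i" "l + j"]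
          phi_set_blocks(2)[OF Y that]
        by (simp add: V_def B_def add.assoc)
      show "X $$ (c + 2 * l + i, c + 2 * l + j) = M $$ (i, j)" if "i < l" "j < l" for i j
        using that c eq[of "c + 2 * l + i" "c + 2 * l + j" 3] X0_entry[of "c + 2 * l + i" "c + 2 * l + j"]
          Z3[OF that]
        by (simp add: V_def B_def add.assoc)
    qed
    then obtain Y' where "Y' \<in> phi_set l U M" "c + mat_rank Y' \<le> mat_rank X" by blast
    with rank[of Y'] show ?thesis by (simp add: M_def c_def)
  qed
  ultimately show ?thesis
    using P G tw by (intro exI[of _ P] exI[of _ G]) auto
qed

theorem theorem1p8:
  fixes \<omega> l n :: nat
  assumes "\<omega> > 0" and "l > 0" and "n > 0"
  shows
    "(n \<ge> \<omega> + l + 1 \<longrightarrow>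
       (\<exists>P G. sdp_problem n P \<and> graph_on n G \<and> splr n G l P \<and>
          pathwidth G = \<omega> \<and> treewidth G = \<omega> \<and> sdp_optimal n P \<noteq> {} \<and>
          (\<forall>X\<in>sdp_optimal n P. mat_rank X \<ge> treewidth G + l + 1))) \<and>
     (\<omega> \<ge> 3 * l - 1 \<and> n \<ge> \<omega> + 3 * l + 1 \<longrightarrow>
       (\<exists>P G. sdp_problem n P \<and> graph_on n G \<and> splr n G l P \<and>
          treewidth G = \<omega> \<and> sdp_optimal n P \<noteq> {} \<and>
          (\<forall>X\<in>sdp_optimal n P. mat_rank X \<ge> treewidth G + phi l + 1)))"
  \<comment> \<open>On natural numbers \<open>\<omega> \<ge> 3 * l - 1\<close> amounts to
    \<open>3 * l \<le> Suc \<omega>\<close>.\<close>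
  using sdp_rank_pathwidth[of \<omega> l n] sdp_rank_treewidth[OF assms(2), of \<omega> n] by auto

end
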